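(* Let $\varphi$ be an increasing concave function on $[0,1]$ with $\varphi(0)=0$ and $\delta_\varphi<1$. Then the Marcinkiewicz space $M_\varphi$ is $w$-decomposable for some non-trivial weight $w$ on $[0,1]$ if and only if $\varphi$ is equivalent to a quasi-concave function on $[0,1]$ that is regularly varying at zero of order $\infty$.
   Context: $m$ is Lebesgue measure; functions are identified if they agree a.e., and $\operatorname{supp}x$ and infima/suprema of $w$ over sets are understood up to null sets. For measurable $x$ on $[0,1]$, $x^*(t)=\inf\{\lambda>0: m\{|x|>\lambda\}\le t\}$ and $x^{**}(t)=\frac1t\int_0^tx^*(s)\,ds$. The Marcinkiewicz space $M_\varphi$ consists of measurable $x$ on $[0,1]$ with $\|x\|_{M_\varphi}=\sup_{0<t\le1}\varphi(t)x^{**}(t)<\infty$. The upper dilation index is $\delta_\varphi=\lim_{t\to\infty}\frac{\ln\bar\varphi(t)}{\ln t}$, where $\bar\varphi(t)=\sup\{\varphi(st)/\varphi(s): s,st\in(0,1]\}$. A function $\psi:[0,1]\to[0,\infty)$ is quasi-concave if $\psi(0)=0$, $\psi$ is non-decreasing and $\psi(t)/t$ is non-increasing on $(0,1]$. It is regularly varying at zero of order $\infty$ if $\lim_{t\to0^+}\psi(tu)/\psi(t)=1$ for all $u>0$. Two functions are equivalent if each is bounded by a constant multiple of the other. A weight on $[0,1]$ is a measurable function that is positive and finite a.e.; it is non-trivial if $w$ or $1/w$ is unbounded. A space $X$ of functions is $w$-decomposable if there is $C>0$ such that for every $n\in\mathbb N$ and all nonzero $x_1,\dots,x_n,y_1,\dots,y_n\in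 X$ with $\|x_i\|_X=\|y_i\|_X$ ($1\le i\le n$) and $\inf w(\operatorname{supp}x_i\cup\operatorname{supp}y_i)\ge 2\sup w(\operatorname{supp}x_{i+1}\cup\operatorname{supp}y_{i+1})$ ($1\le i\le n-1$), one has $C^{-1}\|\sum_{i=1}^n x_i\|_X\le\|\sum_{i=1}^n y_i\|_X\le C\|\sum_{i=1}^n x_i\|_X$. *)

theory Defs
  imports "HOL-Analysis.Analysis" "HOL-Probability.Essential_Supremum"
begin

text \<open>
  Functions on the unit interval are total functions \<^typ>\<open>real \<Rightarrow> real\<close> of which only the
  values on \<open>{0..1}\<close> matter. They are not quotiented by a.e. equality; instead every notion
  below is invariant under changes on null sets.
\<close>

text \<open>Extended values are used since the infimum is infinite for unbounded \<open>x\<close> at \<open>t = 0\<close>, and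
  the average is infinite for non-integrable \<open>x\<close>.\<close>

definition decreasing_rearrangement :: "(real \<Rightarrow> real) \<Rightarrow> real \<Rightarrow> ennreal" where
  "decreasing_rearrangement x t =
     (INF l\<in>{l::real. 0 < l \<and> emeasure lebesgue {s\<in>{0..1}. \<bar>x s\<bar> > l} \<le> ennreal t}. ennreal l)"

definition maximal_rearrangement :: "(real \<Rightarrow> real) \<Rightarrow> real \<Rightarrow> ennreal" where
  "maximal_rearrangement x t =
     (\<integral>\<^sup>+ s\<in>{0..t}. decreasing_rearrangement x s \<partial>lebesgue) / ennreal t"

definition marcinkiewicz_enorm :: "(real \<Rightarrow> real) \<Rightarrow> (real \<Rightarrow> real) \<Rightarrow> ennreal" where
  "marcinkiewicz_enorm \<phi> x = (SUP t\<in>{0<..1}. ennreal (\<phi> t) * maximal_rearrangement x t)"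

definition marcinkiewicz_space :: "(real \<Rightarrow> real) \<Rightarrow> (real \<Rightarrow> real) set" where
  "marcinkiewicz_space \<phi> =
     {x. x \<in> borel_measurable (lebesgue_on {0..1}) \<and> marcinkiewicz_enorm \<phi> x < \<infinity>}"

definition marcinkiewicz_norm :: "(real \<Rightarrow> real) \<Rightarrow> (real \<Rightarrow> real) \<Rightarrow> real" where
  "marcinkiewicz_norm \<phi> x = enn2real (marcinkiewicz_enorm \<phi> x)"

definition dilation_function :: "(real \<Rightarrow> real) \<Rightarrow> real \<Rightarrow> real" where
  "dilation_function \<phi> t = (SUP s\<in>{s. s \<in> {0<..1} \<and> s * t \<in> {0<..1}}. \<phi> (s * t) / \<phi> s)"

definition upper_dilation_index :: "(real \<Rightarrow> real) \<Rightarrow> real" where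
  "upper_dilation_index \<phi> = Lim at_top (\<lambda>t. ln (dilation_function \<phi> t) / ln t)"

definition quasi_concave :: "(real \<Rightarrow> real) \<Rightarrow> bool" where
  "quasi_concave \<psi> \<longleftrightarrow>
     (\<forall>t\<in>{0..1}. 0 \<le> \<psi> t) \<and> \<psi> 0 = 0 \<and> mono_on {0..1} \<psi> \<and>
     antimono_on {0<..1} (\<lambda>t. \<psi> t / t)"

definition regularly_varying_at_zero_of_order_infinity :: "(real \<Rightarrow> real) \<Rightarrow> bool" where
  "regularly_varying_at_zero_of_order_infinity \<psi> \<longleftrightarrow>
     (\<forall>u>0. ((\<lambda>t. \<psi> (t * u) / \<psi> t) \<longlongrightarrow> 1) (at_right 0))"

definition equivalent_functions :: "(real \<Rightarrow> real) \<Rightarrow> (real \<Rightarrow> real) \<Rightarrow> bool" where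
  "equivalent_functions \<phi> \<psi> \<longleftrightarrow>
     (\<exists>C>0. \<forall>t\<in>{0..1}. \<phi> t \<le> C * \<psi> t) \<and> (\<exists>C>0. \<forall>t\<in>{0..1}. \<psi> t \<le> C * \<phi> t)"

definition weight :: "(real \<Rightarrow> real) \<Rightarrow> bool" where
  "weight w \<longleftrightarrow>
     w \<in> borel_measurable (lebesgue_on {0..1}) \<and> (AE s in lebesgue_on {0..1}. 0 < w s)"

definition essentially_bounded_above :: "(real \<Rightarrow> real) \<Rightarrow> bool" where
  "essentially_bounded_above f \<longleftrightarrow> (\<exists>K. AE s in lebesgue_on {0..1}. f s \<le> K)"

definition nontrivial_weight :: "(real \<Rightarrow> real) \<Rightarrow> bool" where
  "nontrivial_weight w \<longleftrightarrow>
     weight w \<and> (\<not> essentially_bounded_above w \<or> \<not> essentially_bounded_above (\<lambda>s. 1 / w s))"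

definition supp :: "(real \<Rightarrow> real) \<Rightarrow> real set" where
  "supp x = {s\<in>{0..1}. x s \<noteq> 0}"

definition nonzero_function :: "(real \<Rightarrow> real) \<Rightarrow> bool" where
  "nonzero_function x \<longleftrightarrow> \<not> (AE s in lebesgue_on {0..1}. x s = 0)"

definition sup_on :: "(real \<Rightarrow> real) \<Rightarrow> real set \<Rightarrow> ereal" where
  "sup_on w A = esssup (lebesgue_on A) (\<lambda>s. ereal (w s))"

definition inf_on :: "(real \<Rightarrow> real) \<Rightarrow> real set \<Rightarrow> ereal" where
  "inf_on w A = - esssup (lebesgue_on A) (\<lambda>s. - ereal (w s))"

definition decomposable ::
    "(real \<Rightarrow> real) \<Rightarrow> (real \<Rightarrow> real) set \<Rightarrow> ((real \<Rightarrow> real) \<Rightarrow> real) \<Rightarrow> bool" where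
  "decomposable w X N \<longleftrightarrow>
     (\<exists>C>0. \<forall>n\<ge>1. \<forall>(x :: nat \<Rightarrow> real \<Rightarrow> real) y.
        (\<forall>i\<in>{1..n}. x i \<in> X \<and> y i \<in> X \<and> nonzero_function (x i) \<and> nonzero_function (y i) \<and>
           N (x i) = N (y i)) \<and>
        (\<forall>i\<in>{1..<n}. inf_on w (supp (x i) \<union> supp (y i)) \<ge>
           2 * sup_on w (supp (x (i + 1)) \<union> supp (y (i + 1)))) \<longrightarrow>
        inverse C * N (\<lambda>s. \<Sum>i=1..n. x i s) \<le> N (\<lambda>s. \<Sum>i=1..n. y i s) \<and>
        N (\<lambda>s. \<Sum>i=1..n. y i s) \<le> C * N (\<lambda>s. \<Sum>i=1..n. x i s))"

end

theory Submission
  imports Defs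
begin

text \<open>
  If \<open>\<delta>\<^sub>\<phi> < 1\<close>, the Marcinkiewicz norm of \<open>x\<close> is equivalent to \<open>sup {l \<phi>(d(l)) | l > 0}\<close>, where \<open>d\<close> is
  the distribution function of \<open>x\<close>. Both sides of the theorem are then equivalent to the existence of
  one constant \<open>C\<close> such that for every \<open>n\<close> the inequality \<open>\<phi>(n t) \<le> C \<phi>(t)\<close> holds for all small \<open>t\<close>.

  Given a non-trivial weight, one finds arbitrarily many disjoint non-null layers of it. Normalised
  indicators of sets of geometrically decreasing measures in these layers have a sum of bounded norm,
  while normalised indicators of \<open>n\<close> sets of the same measure \<open>t\<close> have a sum of norm \<open>\<phi>(n t) / \<phi>(t)\<close>.
  Decomposability compares the two.

  Conversely, if the measures \<open>c\<^sub>j\<close> of the sets \<open>{w \<le> 2\<^sup>-\<^sup>j}\<close> decrease fast enough, functions with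
  separated supports satisfy the upper and lower estimates of an \<open>\<ell>\<^sub>\<infinity>\<close>-sum: if \<open>s\<close> is the largest of
  the values \<open>d\<^sub>i(l)\<close> and \<open>c\<^bsub>j+1\<^esub> < s \<le> c\<^sub>j\<close>, the distribution function of the sum is at most \<open>(j + 2) s\<close>,
  and \<open>\<phi>((j + 2) s) \<le> C \<phi>(s)\<close> by the choice of \<open>c\<^sub>j\<close>.
\<close>

section \<open>Distribution functions and the layer cake formula\<close>

definition distribution_function :: "(real \<Rightarrow> real) \<Rightarrow> real \<Rightarrow> real" where
  "distribution_function x l = measure lebesgue {s\<in>{0..1}. l < \<bar>x s\<bar>}"

text \<open>Holds for every \<open>x\<close>: a set outside \<open>sets lebesgue\<close> gets the
  value 0 on both sides, and all others have measure at most 1.\<close>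

lemma emeasure_eq_distribution_function:
  "emeasure lebesgue {s\<in>{0..1}. l < \<bar>x s\<bar>} = ennreal (distribution_function x l)"
proof -
  have "emeasure lebesgue {s\<in>{0..1}. l < \<bar>x s\<bar>} \<le> emeasure lebesgue {0..1::real}"
    by (rule emeasure_mono) auto
  also have "\<dots> < \<infinity>"
    by simp
  finally show ?thesis
    unfolding distribution_function_def by (intro emeasure_eq_ennreal_measure) auto
qed

lemma distribution_function_nonneg [simp]: "0 \<le> distribution_function x l"
  by (simp add: distribution_function_def)

lemma superlevel_sets_lebesgue:
  fixes x :: "real \<Rightarrow> real"
  assumes "x \<in> borel_measurable (lebesgue_on {0..1})"
  shows "{s\<in>{0..1}. l < \<bar>x s\<bar>} \<in> sets lebesgue"
proof -
  have "{s \<in> space (lebesgue_on {0..1}). l < \<bar>x s\<bar>} \<in> sets (lebesgue_on {0..1})"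
    using assms by measurable
  then show ?thesis
    by (simp add: sets_restrict_space_iff)
qed

lemma superlevel_fmeasurable:
  fixes x :: "real \<Rightarrow> real"
  assumes "x \<in> borel_measurable (lebesgue_on {0..1})"
  shows "{s\<in>{0..1}. l < \<bar>x s\<bar>} \<in> fmeasurable lebesgue"
  by (rule fmeasurableI2[of "{0..1::real}"]) (use superlevel_sets_lebesgue[OF assms] in auto)

lemma distribution_function_le_1: "distribution_function x l \<le> 1"
proof -
  have "emeasure lebesgue {s\<in>{0..1}. l < \<bar>x s\<bar>} \<le> emeasure lebesgue {0..1::real}"
    by (rule emeasure_mono) auto
  then show ?thesis
    unfolding emeasure_eq_distribution_function by (simp add: ennreal_le_1)
qed

lemma antimono_distribution_function:
  assumes "x \<in> borel_measurable (lebesgue_on {0..1})"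
  shows "antimono (distribution_function x)"
  unfolding distribution_function_def
  by (intro monotoneI measure_mono_fmeasurable superlevel_fmeasurable superlevel_sets_lebesgue assms)
     auto

lemma borel_measurable_distribution_function:
  assumes "x \<in> borel_measurable (lebesgue_on {0..1})"
  shows "distribution_function x \<in> borel_measurable borel"
proof -
  have "mono (\<lambda>l. - distribution_function x l)"
    using antimono_distribution_function[OF assms] by (auto simp: monotone_def)
  from borel_measurable_mono[OF this] have "(\<lambda>l. - (- distribution_function x l)) \<in> borel_measurable borel"
    by measurable
  then show ?thesis by simp
qed

text \<open>Since the distribution function decreases, the levels \<open>l > 0\<close> with
  \<open>s < distribution_function x l\<close> form an interval starting at 0, and the infimum that
  defines the rearrangement is its length.\<close>

lemma decreasing_rearrangement_layer_cake:
  assumes x: "x \<in> borel_measurable (lebesgue_on {0..1})" and s: "0 \<le> s"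
  shows "decreasing_rearrangement x s =
    (\<integral>\<^sup>+ l. indicator {0<..} l * indicator {..<distribution_function x l} s \<partial>lborel)"
proof -
  let ?d = "distribution_function x"
  let ?A = "{l. 0 < l \<and> s < ?d l}"
  note [measurable] = borel_measurable_distribution_function[OF x]
  have A: "?A \<in> sets lborel" by measurable
  have dr: "decreasing_rearrangement x s = (INF l\<in>{l. 0 < l \<and> ?d l \<le> s}. ennreal l)"
    unfolding decreasing_rearrangement_def emeasure_eq_distribution_function
    using s by simp
  have "(\<integral>\<^sup>+ l. indicator {0<..} l * indicator {..<?d l} s \<partial>lborel) = (\<integral>\<^sup>+ l. indicator ?A l \<partial>lborel)"
    by (intro nn_integral_cong) (auto simp: indicator_def)
  also have "\<dots> = emeasure lborel ?A"
    using A by simp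
  also have "\<dots> = decreasing_rearrangement x s"
  proof (rule antisym)
    show "emeasure lborel ?A \<le> decreasing_rearrangement x s"
      unfolding dr
    proof (rule INF_greatest)
      fix l assume l: "l \<in> {l. 0 < l \<and> ?d l \<le> s}"
      have "?A \<subseteq> {0..l}"
      proof
        fix k assume k: "k \<in> ?A"
        show "k \<in> {0..l}"
        proof (cases "k \<le> l")
          case False
          then have "?d k \<le> ?d l"
            using antimono_distribution_function[OF x] by (auto simp: monotone_def)
          then show ?thesis using k l by auto
        qed (use k in auto)
      qed
      then have "emeasure lborel ?A \<le> emeasure lborel {0..l}"
        by (rule emeasure_mono) auto
      then show "emeasure lborel ?A \<le> ennreal l"
        using l by simp
    qed
    show "decreasing_rearrangement x s \<le> emeasure lborel ?A"
    \<comment> \<open>Comparing with each finite \<open>y\<close> below the infimum also covers an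
      infinite infimum, as for unbounded \<open>x\<close> at \<open>s = 0\<close>.\<close>
    proof (rule dense_le)
      fix y assume y: "y < decreasing_rearrangement x s"
      then obtain r where r: "y = ennreal r" "0 \<le> r"
        by (cases y) auto
      have "{0<..r} \<subseteq> ?A"
      proof
        fix l assume l: "l \<in> {0<..r}"
        have "s < ?d l"
        proof (rule ccontr)
          assume "\<not> s < ?d l"
          with l have "l \<in> {l. 0 < l \<and> ?d l \<le> s}"
            by auto
          with y have "y < ennreal l"
            unfolding dr by (rule less_INF_D)
          with l r show False
            by (auto simp: ennreal_less_iff)
        qed
        with l show "l \<in> ?A" by auto
      qed
      then have "emeasure lborel {0<..r} \<le> emeasure lborel ?A"
        using A by (rule emeasure_mono)
      then show "y \<le> emeasure lborel ?A"
        using r by simp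
    qed
  qed
  finally show ?thesis ..
qed

text \<open>Fubini for the planar region \<open>0 \<le> s \<le> t\<close>, \<open>0 < l\<close>,
  \<open>s < distribution_function x l\<close>: its section at level \<open>l\<close> has length
  \<open>min t (distribution_function x l)\<close>.\<close>

lemma integral_decreasing_rearrangement:
  assumes x: "x \<in> borel_measurable (lebesgue_on {0..1})" and t: "0 \<le> t"
  shows "(\<integral>\<^sup>+ s\<in>{0..t}. decreasing_rearrangement x s \<partial>lebesgue) =
    (\<integral>\<^sup>+ l. ennreal (min t (distribution_function x l)) * indicator {0<..} l \<partial>lborel)"
proof -
  let ?d = "distribution_function x"
  note [measurable] = borel_measurable_distribution_function[OF x]
  have "(\<integral>\<^sup>+ s\<in>{0..t}. decreasing_rearrangement x s \<partial>lebesgue) =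
      (\<integral>\<^sup>+ s. decreasing_rearrangement x s * indicator {0..t} s \<partial>lborel)"
    by (rule nn_integral_completion)
  also have "\<dots> = (\<integral>\<^sup>+ s. (\<integral>\<^sup>+ l. indicator {(s, l). 0 \<le> s \<and> s \<le> t \<and> 0 < l \<and> s < ?d l} (s, l)
      \<partial>lborel) \<partial>lborel)"
  proof (rule nn_integral_cong)
    fix s :: real
    show "decreasing_rearrangement x s * indicator {0..t} s =
      (\<integral>\<^sup>+ l. indicator {(s, l). 0 \<le> s \<and> s \<le> t \<and> 0 < l \<and> s < ?d l} (s, l) \<partial>lborel)"
    proof (cases "0 \<le> s \<and> s \<le> t")
      case True
      then show ?thesis
        by (auto simp: decreasing_rearrangement_layer_cake[OF x] indicator_def intro!: nn_integral_cong)
    qed (auto simp: indicator_def)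
  qed
  also have "\<dots> = (\<integral>\<^sup>+ l. (\<integral>\<^sup>+ s. indicator {(s, l). 0 \<le> s \<and> s \<le> t \<and> 0 < l \<and> s < ?d l} (s, l)
      \<partial>lborel) \<partial>lborel)"
    by (rule lborel_pair.Fubini[symmetric]) measurable
  also have "\<dots> = (\<integral>\<^sup>+ l. ennreal (min t (?d l)) * indicator {0<..} l \<partial>lborel)"
  proof (rule nn_integral_cong)
    fix l :: real
    have "(\<integral>\<^sup>+ s. indicator {(s, l). 0 \<le> s \<and> s \<le> t \<and> 0 < l \<and> s < ?d l} (s, l) \<partial>lborel) =
      (\<integral>\<^sup>+ s. indicator (if 0 < l then {0..t} \<inter> {0..<?d l} else {}) s \<partial>lborel)"
      by (intro nn_integral_cong) (auto simp: indicator_def)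
    also have "\<dots> = emeasure lborel (if 0 < l then {0..t} \<inter> {0..<?d l} else {})"
      by (rule nn_integral_indicator) auto
    also have "{0..t} \<inter> {0..<?d l} = (if t < ?d l then {0..t} else {0..<?d l})"
      by auto
    also have "emeasure lborel (if 0 < l then (if t < ?d l then {0..t} else {0..<?d l}) else {}) =
        ennreal (min t (?d l)) * indicator {0<..} l"
      using t by (auto simp: min_def)
    finally show "(\<integral>\<^sup>+ s. indicator {(s, l). 0 \<le> s \<and> s \<le> t \<and> 0 < l \<and> s < ?d l} (s, l) \<partial>lborel) =
        ennreal (min t (?d l)) * indicator {0<..} l" .
  qed
  finally show ?thesis .
qed

lemma borel_measurable_scaled_indicator:
  fixes c :: real
  assumes "B \<in> sets lebesgue"
  shows "(\<lambda>s. c * indicator B s) \<in> borel_measurable (lebesgue_on {0..1})"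
  using assms by (intro measurable_restrict_space1 borel_measurable_times borel_measurable_const
      borel_measurable_indicator)

lemma distribution_function_indicator:
  assumes B: "B \<in> sets lebesgue" "B \<subseteq> {0..1}" "measure lebesgue B = b" and c: "0 < c" and l: "0 < l"
  shows "distribution_function (\<lambda>s. c * indicator B s) l = (if l < c then b else 0)"
proof -
  have "{s\<in>{0..1}. l < \<bar>c * indicator B s\<bar>} = (if l < c then B else {})"
    using l B c by (auto simp: indicator_def)
  then show ?thesis by (simp add: distribution_function_def B)
qed

section \<open>The weak form of the Marcinkiewicz norm\<close>

text \<open>\<open>quasi_concave\<close> admits the zero function, so positivity away from 0 is
  assumed separately.\<close>

locale fundamental_function =
  fixes \<phi> :: "real \<Rightarrow> real"
  assumes quasi_concave: "quasi_concave \<phi>"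
    and pos: "\<And>t. 0 < t \<Longrightarrow> t \<le> 1 \<Longrightarrow> 0 < \<phi> t"
begin

lemma zero [simp]: "\<phi> 0 = 0"
  using quasi_concave by (simp add: quasi_concave_def)

lemma nonneg: "0 \<le> t \<Longrightarrow> t \<le> 1 \<Longrightarrow> 0 \<le> \<phi> t"
  using quasi_concave by (simp add: quasi_concave_def)

lemma mono: "0 \<le> s \<Longrightarrow> s \<le> t \<Longrightarrow> t \<le> 1 \<Longrightarrow> \<phi> s \<le> \<phi> t"
  using quasi_concave by (auto simp: quasi_concave_def monotone_on_def)

lemma slope_antimono: "0 < s \<Longrightarrow> s \<le> t \<Longrightarrow> t \<le> 1 \<Longrightarrow> \<phi> t / t \<le> \<phi> s / s"
  using quasi_concave by (auto simp: quasi_concave_def monotone_on_def)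

text \<open>Monotonicity handles \<open>t \<le> s\<close>, the decreasing slope the rest. The
  inequality \<open>t \<le> a * s\<close> in place of an equation makes the estimate applicable to
  arguments truncated at 1 and to values of distribution functions.\<close>

lemma dilation_le:
  assumes "0 \<le> s" "s \<le> 1" "0 \<le> t" "t \<le> 1" "1 \<le> a" "t \<le> a * s"
  shows "\<phi> t \<le> a * \<phi> s"
proof (cases "t \<le> s")
  case True
  then have "\<phi> t \<le> \<phi> s" using mono assms by auto
  also have "\<dots> \<le> a * \<phi> s" using assms nonneg[of s] by (simp add: mult_le_cancel_right1)
  finally show ?thesis .
next
  case False
  with assms have s: "0 < s" by (cases "s = 0") auto
  have "\<phi> t \<le> (t / s) * \<phi> s"
    using slope_antimono[of s t] False s assms by (simp add: field_simps)
  also have "\<dots> \<le> a * \<phi> s"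
    using s assms nonneg[of s] by (intro mult_right_mono) (auto simp: field_simps)
  finally show ?thesis .
qed

text \<open>The norm depends on \<open>x\<close> only through its distribution function; the norm
  estimates below rest on this formula.\<close>

lemma enorm_eq:
  assumes "x \<in> borel_measurable (lebesgue_on {0..1})"
  shows "marcinkiewicz_enorm \<phi> x = (SUP t\<in>{0<..1}. ennreal (\<phi> t / t) *
    (\<integral>\<^sup>+ l. ennreal (min t (distribution_function x l)) * indicator {0<..} l \<partial>lborel))"
  unfolding marcinkiewicz_enorm_def maximal_rearrangement_def
proof (intro SUP_cong refl)
  fix t :: real assume t: "t \<in> {0<..1}"
  then have "ennreal (\<phi> t / t) = ennreal (\<phi> t) / ennreal t"
    using nonneg[of t] by (simp add: divide_ennreal)
  then show "ennreal (\<phi> t) * ((\<integral>\<^sup>+ s\<in>{0..t}. decreasing_rearrangement x s \<partial>lebesgue) / ennreal t) =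
     ennreal (\<phi> t / t) *
       (\<integral>\<^sup>+ l. ennreal (min t (distribution_function x l)) * indicator {0<..} l \<partial>lborel)"
    using integral_decreasing_rearrangement[OF assms, of t] t
    by (simp add: ennreal_times_divide ennreal_divide_times mult_ac)
qed

text \<open>The supremum is tested at \<open>t = distribution_function x l\<close>: up to the level
  \<open>l\<close> the distribution function is at least \<open>t\<close>, so the integral is at
  least \<open>t * l\<close>.\<close>

lemma weak_le_enorm:
  assumes x: "x \<in> borel_measurable (lebesgue_on {0..1})" and l: "0 < l"
  shows "ennreal (l * \<phi> (distribution_function x l)) \<le> marcinkiewicz_enorm \<phi> x"
proof (cases "distribution_function x l = 0")
  case False
  define t where "t = distribution_function x l"
  have t: "0 < t" "t \<le> 1"
    using False by (auto simp: t_def distribution_function_le_1 less_le)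
  have "ennreal (l * \<phi> t) = ennreal (\<phi> t / t) * (ennreal t * ennreal l)"
    using t l nonneg[of t] by (simp flip: ennreal_mult)
  also have "ennreal t * ennreal l = (\<integral>\<^sup>+ k. ennreal t * indicator {0<..l} k \<partial>lborel)"
    using l t by (simp add: nn_integral_cmult_indicator)
  also have "\<dots> \<le> (\<integral>\<^sup>+ k. ennreal (min t (distribution_function x k)) * indicator {0<..} k \<partial>lborel)"
  proof (rule nn_integral_mono)
    fix k :: real
    have "t \<le> distribution_function x k" if "k \<le> l"
      using antimonoD[OF antimono_distribution_function[OF x] that] by (simp add: t_def)
    then show "ennreal t * indicator {0<..l} k \<le>
        ennreal (min t (distribution_function x k)) * indicator {0<..} k"
      by (auto simp: indicator_def min_def)
  qed
  also have "ennreal (\<phi> t / t) * \<dots> \<le> marcinkiewicz_enorm \<phi> x"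
    unfolding enorm_eq[OF x] using t by (intro SUP_upper) auto
  finally show ?thesis
    by (simp add: t_def mult_left_mono)
qed simp

lemma enorm_mono:
  assumes "x \<in> borel_measurable (lebesgue_on {0..1})" "y \<in> borel_measurable (lebesgue_on {0..1})"
    and "\<And>l. 0 < l \<Longrightarrow> distribution_function x l \<le> distribution_function y l"
  shows "marcinkiewicz_enorm \<phi> x \<le> marcinkiewicz_enorm \<phi> y"
  unfolding enorm_eq[OF assms(1)] enorm_eq[OF assms(2)]
  by (intro SUP_mono' mult_left_mono nn_integral_mono)
     (use assms(3) in \<open>auto simp: indicator_def intro!: ennreal_leI min.mono\<close>)

text \<open>The product \<open>\<phi> t / t * min t b\<close> is largest at \<open>t = b\<close>:
  for \<open>t \<le> b\<close> it is \<open>\<phi> t\<close>, beyond that it is \<open>b\<close>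
  times the decreasing slope.\<close>

lemma enorm_indicator:
  assumes B: "B \<in> sets lebesgue" "B \<subseteq> {0..1}" "measure lebesgue B = b" and b: "0 < b" and c: "0 < c"
  shows "marcinkiewicz_enorm \<phi> (\<lambda>s. c * indicator B s) = ennreal (c * \<phi> b)"
proof (rule antisym)
  let ?x = "\<lambda>s. c * indicator B s :: real"
  note x = borel_measurable_scaled_indicator[OF B(1), of c]
  note d = distribution_function_indicator[OF B c]
  \<comment> \<open>At any level below \<open>c\<close> the distribution function equals
    \<open>b\<close>, so its general bound 1 applies.\<close>
  have b1: "b \<le> 1"
    using d[of "c/2"] c distribution_function_le_1[of ?x "c/2"] by auto
  have I: "ennreal (\<phi> t / t) *
        (\<integral>\<^sup>+ l. ennreal (min t (distribution_function ?x l)) * indicator {0<..} l \<partial>lborel) =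
        ennreal (\<phi> t / t * (min t b * c))" if t: "t \<in> {0<..1}" for t
  proof -
    have "(\<integral>\<^sup>+ l. ennreal (min t (distribution_function ?x l)) * indicator {0<..} l \<partial>lborel) =
        (\<integral>\<^sup>+ l. ennreal (min t b) * indicator {0<..<c} l \<partial>lborel)"
      using b t by (intro nn_integral_cong) (auto simp: d split: split_indicator)
    also have "\<dots> = ennreal (min t b * c)"
      using b c t by (simp add: nn_integral_cmult_indicator ennreal_mult)
    also have "ennreal (\<phi> t / t) * \<dots> = ennreal (\<phi> t / t * (min t b * c))"
      using t nonneg[of t] b c by (intro ennreal_mult[symmetric]) auto
    finally show ?thesis .
  qed
  show "marcinkiewicz_enorm \<phi> ?x \<le> ennreal (c * \<phi> b)"
    unfolding enorm_eq[OF x]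
  proof (rule SUP_least)
    fix t :: real assume t: "t \<in> {0<..1}"
    have "\<phi> t / t * (min t b * c) \<le> c * \<phi> b"
    proof (cases "t \<le> b")
      case True
      then show ?thesis using mono[of t b] t b1 c by (simp add: field_simps)
    next
      case False
      then show ?thesis using slope_antimono[of b t] t b c by (simp add: field_simps)
    qed
    then show "ennreal (\<phi> t / t) *
        (\<integral>\<^sup>+ l. ennreal (min t (distribution_function ?x l)) * indicator {0<..} l \<partial>lborel) \<le>
        ennreal (c * \<phi> b)"
      unfolding I[OF t] by (rule ennreal_leI)
  qed
  have "ennreal (c * \<phi> b) = ennreal (\<phi> b / b * (min b b * c))"
    using b by (simp add: field_simps)
  also have "\<dots> = ennreal (\<phi> b / b) *
        (\<integral>\<^sup>+ l. ennreal (min b (distribution_function ?x l)) * indicator {0<..} l \<partial>lborel)"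
    using b b1 by (intro I[symmetric]) auto
  also have "\<dots> \<le> marcinkiewicz_enorm \<phi> ?x"
    unfolding enorm_eq[OF x] using b b1 by (intro SUP_upper) auto
  finally show "ennreal (c * \<phi> b) \<le> marcinkiewicz_enorm \<phi> ?x" .
qed

text \<open>Levels are sorted by the scale \<open>t / T ^ k\<close> of
  \<open>min t (distribution_function x l)\<close>. The weak bound confines the levels of scale
  \<open>k\<close> to \<open>l \<le> W / \<phi> (t / T ^ Suc k)\<close>, and iterating the
  contraction turns the sum over all scales into a geometric series of ratio
  \<open>c\<close>.\<close>

lemma enorm_le_weak:
  assumes T: "1 < T" and c: "0 < c" "c < 1"
    and contr: "\<And>s. 0 < s \<Longrightarrow> s * T \<le> 1 \<Longrightarrow> \<phi> (s * T) \<le> c * T * \<phi> s"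
    and x: "x \<in> borel_measurable (lebesgue_on {0..1})"
    and W: "0 \<le> W" "\<And>l. 0 < l \<Longrightarrow> l * \<phi> (distribution_function x l) \<le> W"
  shows "marcinkiewicz_enorm \<phi> x \<le> ennreal (c * T / (1 - c) * W)"
  unfolding enorm_eq[OF x]
proof (rule SUP_least)
  fix t :: real assume t: "t \<in> {0<..1}"
  let ?d = "distribution_function x"
  have tT: "0 < t / T ^ k" "t / T ^ k \<le> 1" for k
    using t T by (auto simp: field_simps intro: order_trans[of t 1])
  have iter: "\<phi> t \<le> (c * T) ^ k * \<phi> (t / T ^ k)" for k
  proof (induction k)
    case (Suc k)
    have "\<phi> (t / T ^ k) = \<phi> (t / T ^ Suc k * T)"
      using T by (simp add: field_simps)
    also have "\<dots> \<le> c * T * \<phi> (t / T ^ Suc k)"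
      using T tT[of k] tT[of "Suc k"] by (intro contr) (auto simp: field_simps)
    finally have "(c * T) ^ k * \<phi> (t / T ^ k) \<le> (c * T) ^ k * (c * T * \<phi> (t / T ^ Suc k))"
      using c T by (intro mult_left_mono) auto
    with Suc show ?case by (simp add: mult_ac)
  qed simp
  have term_le: "g k \<le> suminf g" for g :: "nat \<Rightarrow> ennreal" and k
    using sum_le_suminf[of g "{k}"] by simp
  define b where "b k = W / \<phi> (t / T ^ Suc k)" for k
  have b0: "0 \<le> b k" for k
    unfolding b_def using W pos[OF tT[of "Suc k"]] by (intro divide_nonneg_pos) auto
  \<comment> \<open>Only the summand for the scale of \<open>l\<close> is estimated; the others are
    nonnegative.\<close>
  have pt: "ennreal (min t (?d l)) * indicator {0<..} l \<le>
      (\<Sum>k. ennreal (t / T ^ k) * indicator {0<..b k} l)" for l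
  proof (cases "0 < l \<and> ?d l \<noteq> 0")
    case True
    then have l: "0 < l" and d: "0 < ?d l" by (auto simp: less_le)
    define m where "m = min t (?d l)"
    have m: "0 < m" "m \<le> t" "m \<le> ?d l" using d t by (auto simp: m_def)
    have "\<exists>n. t / m < T ^ n"
      using T real_arch_pow by blast
    \<comment> \<open>\<open>n\<close> is positive because \<open>m \<le> t\<close>. With
      \<open>n = Suc k\<close>, minimality places \<open>m\<close> between
      \<open>t / T ^ Suc k\<close> and \<open>t / T ^ k\<close>.\<close>
    define n where "n = (LEAST n. t / m < T ^ n)"
    have n: "t / m < T ^ n"
      unfolding n_def by (rule LeastI_ex) fact
    have "n \<noteq> 0"
      using n m by (intro notI) (simp add: field_simps)
    then obtain k where k: "n = Suc k" by (cases n) auto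
    have "\<not> t / m < T ^ k"
      using not_less_Least[of k "\<lambda>n. t / m < T ^ n"] k by (simp add: n_def)
    then have mk: "m \<le> t / T ^ k"
      using m T by (simp add: field_simps)
    have "t / T ^ Suc k \<le> m"
      using n k m T by (simp add: field_simps)
    then have "\<phi> (t / T ^ Suc k) \<le> \<phi> (?d l)"
      using m tT[of "Suc k"] by (intro mono distribution_function_le_1) auto
    then have "l * \<phi> (t / T ^ Suc k) \<le> l * \<phi> (?d l)"
      using l by simp
    also have "\<dots> \<le> W" by (rule W) fact
    finally have "l \<le> b k"
      using pos[OF tT[of "Suc k"]] by (simp add: b_def field_simps)
    then have "ennreal m * indicator {0<..} l \<le> ennreal (t / T ^ k) * indicator {0<..b k} l"
      using mk l by (auto intro: ennreal_leI)
    also have "\<dots> \<le> (\<Sum>k. ennreal (t / T ^ k) * indicator {0<..b k} l)"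
      by (rule term_le)
    finally show ?thesis by (simp add: m_def)
  qed (use t in \<open>auto simp: indicator_def\<close>)
  have "(\<integral>\<^sup>+ l. ennreal (min t (?d l)) * indicator {0<..} l \<partial>lborel) \<le>
      (\<integral>\<^sup>+ l. (\<Sum>k. ennreal (t / T ^ k) * indicator {0<..b k} l) \<partial>lborel)"
    by (intro nn_integral_mono pt)
  also have "\<dots> = (\<Sum>k. ennreal (t / T ^ k * b k))"
  proof (subst nn_integral_suminf)
    show "(\<Sum>k. \<integral>\<^sup>+ l. ennreal (t / T ^ k) * indicator {0<..b k} l \<partial>lborel) =
        (\<Sum>k. ennreal (t / T ^ k * b k))"
      using b0 ennreal_mult[OF less_imp_le[OF tT(1)] b0]
      by (intro suminf_cong) (simp add: nn_integral_cmult_indicator)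
  qed auto
  also have "\<dots> \<le> (\<Sum>k. ennreal (t * W * c * T / \<phi> t * c ^ k))"
  proof (intro suminf_le ennreal_leI)
    fix k
    have "W / \<phi> (t / T ^ Suc k) \<le> W * ((c * T) ^ Suc k / \<phi> t)"
      using iter[of "Suc k"] pos[OF tT[of "Suc k"]] pos[of t] t W
      by (subst divide_inverse) (intro mult_left_mono, auto simp: field_simps)
    then have "t / T ^ k * b k \<le> t / T ^ k * (W * ((c * T) ^ Suc k / \<phi> t))"
      unfolding b_def using tT[of k] by (intro mult_left_mono) auto
    also have "\<dots> = t * W * c * T / \<phi> t * c ^ k"
      using T by (simp add: field_simps power_mult_distrib)
    finally show "t / T ^ k * b k \<le> t * W * c * T / \<phi> t * c ^ k" .
  qed auto
  also have "\<dots> = ennreal (t * W * c * T / \<phi> t * (1 / (1 - c)))"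
    using c t W T pos[of t]
    by (intro suminf_ennreal_eq sums_mult geometric_sums) auto
  finally have "ennreal (\<phi> t / t) * (\<integral>\<^sup>+ l. ennreal (min t (?d l)) * indicator {0<..} l \<partial>lborel) \<le>
      ennreal (\<phi> t / t) * ennreal (t * W * c * T / \<phi> t * (1 / (1 - c)))"
    by (rule mult_left_mono) simp
  also have "\<dots> = ennreal (\<phi> t / t * (t * W * c * T / \<phi> t * (1 / (1 - c))))"
    using t c T W pos[of t] by (intro ennreal_mult[symmetric]) auto
  also have "\<phi> t / t * (t * W * c * T / \<phi> t * (1 / (1 - c))) = c * T / (1 - c) * W"
    using t pos[of t] by simp
  finally show "ennreal (\<phi> t / t) * (\<integral>\<^sup>+ l. ennreal (min t (?d l)) * indicator {0<..} l \<partial>lborel) \<le>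
      ennreal (c * T / (1 - c) * W)" .
qed

end

section \<open>Consequences of concavity and of the dilation index\<close>

text \<open>Since \<open>\<phi> 0 = 0\<close>, concavity on the chord from 0 to \<open>t\<close> is
  the slope condition.\<close>

lemma concave_imp_quasi_concave:
  fixes \<phi> :: "real \<Rightarrow> real"
  assumes "mono_on {0..1} \<phi>" "concave_on {0..1} \<phi>" "\<phi> 0 = 0"
  shows "quasi_concave \<phi>"
  unfolding quasi_concave_def
proof (intro conjI ballI monotone_onI)
  fix t :: real assume "t \<in> {0..1}"
  then show "0 \<le> \<phi> t"
    using monotone_onD[OF assms(1), of 0 t] assms(3) by auto
next
  fix s t :: real assume st: "s \<in> {0<..1}" "t \<in> {0<..1}" "s \<le> t"
  have "convex_on {0..1} (\<lambda>x. - \<phi> x)"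
    using assms(2) by (simp add: concave_on_def)
  from convex_onD[OF this, of "s / t" 0 t] st assms(3) have "(s / t) * \<phi> t \<le> \<phi> s"
    by simp
  then show "\<phi> t / t \<le> \<phi> s / s"
    using st by (simp add: field_simps)
qed (use assms in \<open>auto simp: monotone_on_def\<close>)

text \<open>This replaces the limit condition by one scale \<open>T\<close> at which the trivial
  bound \<open>\<phi> (s * T) \<le> T * \<phi> s\<close> improves by a fixed factor. The limit is
  evaluated only in a case where the quotient is eventually constant.\<close>

lemma (in fundamental_function) contraction_of_upper_dilation_index:
  assumes "upper_dilation_index \<phi> < 1"
  obtains T c where "1 < T" "0 < c" "c < 1"
    "\<And>s. 0 < s \<Longrightarrow> s * T \<le> 1 \<Longrightarrow> \<phi> (s * T) \<le> c * T * \<phi> s"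
proof -
  define S where "S T = {s::real. s \<in> {0<..1} \<and> s * T \<in> {0<..1}}" for T
  have df: "dilation_function \<phi> T = (SUP s\<in>S T. \<phi> (s * T) / \<phi> s)" for T
    by (simp add: dilation_function_def S_def)
  \<comment> \<open>\<open>bound\<close> and \<open>inv\<close> make the real supremum meaningful:
    the set is bounded above by \<open>T\<close>, and \<open>1 / T\<close> shows that it is
    nonempty.\<close>
  have bound: "\<phi> (s * T) / \<phi> s \<le> T" if "1 < T" "s \<in> S T" for s T
    using that dilation_le[of s "s * T" T] pos[of s] by (simp add: S_def field_simps)
  have inv: "1 / T \<in> S T" if "1 < T" for T
    using that by (simp add: S_def)
  have le: "dilation_function \<phi> T \<le> T" if "1 < T" for T
    unfolding df using inv[OF that] bound[OF that] by (intro cSUP_least) auto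
  have up: "\<phi> (s * T) / \<phi> s \<le> dilation_function \<phi> T" if "1 < T" "s \<in> S T" for s T
    unfolding df using that bound[OF that(1)] by (intro cSUP_upper bdd_aboveI2[of _ _ T]) auto
  \<comment> \<open>Otherwise the dilation function is the identity on \<open>(1, \<infinity>)\<close>, and the index is 1.\<close>
  have "\<exists>T>1. dilation_function \<phi> T < T"
  proof (rule ccontr)
    assume "\<not> (\<exists>T>1. dilation_function \<phi> T < T)"
    with le have eq: "dilation_function \<phi> T = T" if "1 < T" for T
      using that by (meson antisym not_le)
    have "((\<lambda>t. ln (dilation_function \<phi> t) / ln t) \<longlongrightarrow> 1) at_top"
      using eventually_gt_at_top[of 1]
      by (rule tendsto_eventually[OF eventually_mono]) (simp add: eq)
    then have "upper_dilation_index \<phi> = 1"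
      unfolding upper_dilation_index_def by (intro tendsto_Lim) auto
    with assms show False by simp
  qed
  then obtain T where T: "1 < T" "dilation_function \<phi> T < T" by auto
  have "0 < \<phi> (1 / T * T) / \<phi> (1 / T)"
    using T pos[of "1 / T"] pos[of 1] by simp
  also have "\<dots> \<le> dilation_function \<phi> T"
    using T by (intro up inv) auto
  finally have p: "0 < dilation_function \<phi> T" .
  show thesis
  proof (rule that[of T "dilation_function \<phi> T / T"])
    fix s :: real assume s: "0 < s" "s * T \<le> 1"
    then have "s \<le> 1" using T mult_left_mono[of 1 T s] by linarith
    with s T have "s \<in> S T" by (simp add: S_def)
    from up[OF T(1) this] show "\<phi> (s * T) \<le> dilation_function \<phi> T / T * T * \<phi> s"
      using T pos[of s] s \<open>s \<le> 1\<close> by (simp add: field_simps)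
  qed (use T p in auto)
qed

section \<open>Bounded dilations and slow variation\<close>

text \<open>The order of quantifiers is the content: quasi-concavity alone bounds the quotient by
  \<open>n\<close>, whereas here one \<open>C\<close> serves all \<open>n\<close> and only
  \<open>\<delta>\<close> depends on \<open>n\<close>. The truncation \<open>min 1\<close> keeps the
  argument in the unit interval.\<close>

definition has_bounded_dilations :: "(real \<Rightarrow> real) \<Rightarrow> bool" where
  "has_bounded_dilations \<phi> \<longleftrightarrow>
     (\<exists>C. \<forall>n::nat. \<exists>\<delta>>0. \<forall>t. 0 < t \<and> t \<le> \<delta> \<and> t \<le> 1 \<longrightarrow> \<phi> (min 1 (real n * t)) \<le> C * \<phi> t)"

text \<open>Near 0 the quotient \<open>\<psi> (t * real n) / \<psi> t\<close> is below 2 for each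
  fixed \<open>n\<close>; the passage between \<open>\<phi>\<close> and \<open>\<psi>\<close> costs
  \<open>A\<close> and \<open>B\<close>, which do not depend on \<open>n\<close>.\<close>

lemma (in fundamental_function) has_bounded_dilations_if_equivalent:
  assumes rv: "regularly_varying_at_zero_of_order_infinity \<psi>" and eq: "equivalent_functions \<phi> \<psi>"
  shows "has_bounded_dilations \<phi>"
proof -
  obtain A B where A: "A > 0" "\<And>t. t \<in> {0..1} \<Longrightarrow> \<phi> t \<le> A * \<psi> t"
    and B: "B > 0" "\<And>t. t \<in> {0..1} \<Longrightarrow> \<psi> t \<le> B * \<phi> t"
    using eq unfolding equivalent_functions_def by metis
  have "\<exists>\<delta>>0. \<forall>t. 0 < t \<and> t \<le> \<delta> \<and> t \<le> 1 \<longrightarrow> \<phi> (min 1 (real n * t)) \<le> 2 * A * B * \<phi> t" for n :: nat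
  proof (cases "n = 0")
    case True
    then show ?thesis
      using A B nonneg by (intro exI[of _ 1]) auto
  next
    case False
    then have "((\<lambda>t. \<psi> (t * real n) / \<psi> t) \<longlongrightarrow> 1) (at_right 0)"
      using rv by (simp add: regularly_varying_at_zero_of_order_infinity_def)
    then have "\<forall>\<^sub>F t in at_right 0. \<psi> (t * real n) / \<psi> t < 2"
      by (rule order_tendstoD) simp
    then obtain b where b: "b > 0" "\<And>t. 0 < t \<Longrightarrow> t < b \<Longrightarrow> \<psi> (t * real n) / \<psi> t < 2"
      by (auto simp: eventually_at_right_field)
    show ?thesis
    \<comment> \<open>\<open>b / 2\<close> turns the strict condition \<open>t < b\<close> into a
      closed one, and \<open>1 / real n\<close> makes \<open>min 1\<close> inactive.\<close>
    proof (intro exI[of _ "min (b / 2) (1 / real n)"] conjI allI impI)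
      fix t assume t: "0 < t \<and> t \<le> min (b / 2) (1 / real n) \<and> t \<le> 1"
      then have tn: "t * real n \<le> 1" using False by (simp add: field_simps)
      have "0 < \<phi> t" using t pos by simp
      also have "\<dots> \<le> A * \<psi> t" using t A(2)[of t] by simp
      finally have p: "0 < \<psi> t" using A(1) by (simp add: zero_less_mult_iff)
      have "\<phi> (min 1 (real n * t)) \<le> A * \<psi> (t * real n)"
        using tn t A(2)[of "t * real n"] by (simp add: min_def mult.commute)
      also have "\<dots> \<le> A * (2 * \<psi> t)"
        using b(1) b(2)[of t] t p A(1) by (intro mult_left_mono) (auto simp: field_simps)
      also have "\<dots> \<le> A * (2 * (B * \<phi> t))"
        using B(2)[of t] t A(1) by (intro mult_left_mono) auto
      finally show "\<phi> (min 1 (real n * t)) \<le> 2 * A * B * \<phi> t" by (simp add: mult_ac)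
    qed (use b False in auto)
  qed
  then show ?thesis unfolding has_bounded_dilations_def by blast
qed

text \<open>
  The majorant \<open>q\<close> is the smallest sequence above \<open>f\<close> whose quotients \<open>q (n + 1) / q n\<close> are at least \<open>r n\<close>.
  The factors \<open>r n\<close> tend to 1, but so slowly that their product over a block on which \<open>f\<close> may drop by
  the factor \<open>C\<close> is at most \<open>1 / C\<close>. The block length \<open>len j\<close> grows by at most one in each step, so that
  it at most doubles within a block.
\<close>

lemma slowly_varying_majorant_sequence:
  fixes f :: "nat \<Rightarrow> real"
  assumes pos: "\<And>n. 0 < f n" and dec: "\<And>n. f (Suc n) \<le> f n" and half: "\<And>n. f n \<le> 2 * f (Suc n)"
    and C: "2 \<le> C" and drop: "\<And>L. \<exists>m. \<forall>n\<ge>m. f n \<le> C * f (n + L)"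
  obtains q where "\<And>n. f n \<le> q n" "\<And>n. q n \<le> C * f n" "\<And>n. q (Suc n) \<le> q n"
    "\<And>n. q n \<le> 2 * q (Suc n)" "(\<lambda>n. q (Suc n) / q n) \<longlonglongrightarrow> 1"
proof -
  have f_anti: "f n \<le> f m" if "m \<le> n" for m n
    using dec that by (rule lift_Suc_antimono_le)
  \<comment> \<open>The length is raised only if the drop over the longer block is controlled from
    \<open>Suc j\<close> on; this makes \<open>len_drop\<close> an invariant.\<close>
  define len where "len = rec_nat 1 (\<lambda>j v. if \<forall>n\<ge>Suc j. f n \<le> C * f (n + Suc v) then Suc v else v)"
  have len_0: "len 0 = 1" and len_Suc: "len (Suc j) =
      (if \<forall>n\<ge>Suc j. f n \<le> C * f (n + Suc (len j)) then Suc (len j) else len j)" for j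
    by (simp_all add: len_def)
  have len_drop: "f n \<le> C * f (n + len j)" if "j \<le> n" for j n
    using that
  proof (induction j arbitrary: n)
    case 0
    have "f n \<le> 2 * f (Suc n)" by (rule half)
    also have "\<dots> \<le> C * f (Suc n)" using C pos[of "Suc n"] by simp
    finally show ?case by (simp add: len_0)
  next
    case (Suc j)
    then show ?case by (simp add: len_Suc)
  qed
  have len_mono: "len i \<le> len j" if "i \<le> j" for i j
    by (rule lift_Suc_mono_le[OF _ that]) (simp add: len_Suc)
  have len_pos: "0 < len j" for j
    using len_mono[of 0 j] by (simp add: len_0)
  have len_add: "len (j + i) \<le> len j + i" for i j
    by (induction i) (auto simp: len_Suc)
  \<comment> \<open>Once the index has passed the threshold given by \<open>drop\<close>, a block of
    length \<open>K\<close> is lengthened in the next step.\<close>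
  have "\<exists>j. K \<le> len j" for K
  proof (induction K)
    case (Suc K)
    then obtain j where j: "K \<le> len j" by blast
    obtain m where m: "\<And>n. n \<ge> m \<Longrightarrow> f n \<le> C * f (n + Suc K)" using drop by blast
    let ?i = "max j m"
    have "K \<le> len ?i" using j len_mono[of j ?i] by linarith
    then consider "Suc K \<le> len ?i" | "len ?i = K" by linarith
    then show ?case
    proof cases
      case 2
      then have "len (Suc ?i) = Suc K" using m by (simp add: len_Suc)
      then show ?thesis by (metis order_refl)
    qed blast
  qed auto
  then have len_top: "filterlim len at_top sequentially"
    unfolding filterlim_at_top eventually_sequentially using len_mono order_trans by meson
  \<comment> \<open>The factor 2 in the exponent pays for the possible doubling of
    \<open>len\<close> inside a block, so that the \<open>len m\<close> factors of a block still
    multiply to at most \<open>1 / C\<close>. The lower bound 1/2 in \<open>r\<close> serves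
    \<open>q n \<le> 2 * q (Suc n)\<close>.\<close>
  define e where "e j = exp (- 2 * ln C / real (len j))" for j
  define r where "r j = max (1/2) (e j)" for j
  have r: "1/2 \<le> r j" "0 < r j" "r j \<le> 1" for j
    using C by (auto simp: r_def e_def less_max_iff_disj)
  have "(\<lambda>j. - 2 * ln C / real (len j)) \<longlonglongrightarrow> 0"
    by (intro real_tendsto_divide_at_top[OF tendsto_const] filterlim_compose[OF filterlim_real_sequentially len_top])
  then have "e \<longlonglongrightarrow> exp 0"
    unfolding e_def by (rule tendsto_exp)
  then have "r \<longlonglongrightarrow> max (1/2) (exp 0)"
    unfolding r_def by (intro tendsto_max tendsto_const)
  then have r_lim: "r \<longlonglongrightarrow> 1" by simp
  have prod_le_1: "(\<Prod>j=m..<n. r j) \<le> 1" for m n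
    using r(2,3) by (intro prod_le_1) (auto simp: less_imp_le)
  \<comment> \<open>The induction advances by whole blocks: the gain \<open>1 / C\<close> of the
    factors cancels the drop of \<open>f\<close>, so that \<open>C\<close> is lost only once, on the
    last block. While \<open>e m \<le> 1/2\<close>, single steps with \<open>half\<close>
    suffice.\<close>
  have key: "f m * (\<Prod>j=m..<n. r j) \<le> C * f n" if "m \<le> n" for m n
    using that
  proof (induction "n - m" arbitrary: m rule: less_induct)
    case less
    let ?l = "len m"
    show ?case
    proof (cases "n \<le> m + ?l")
      case True
      have "f m * (\<Prod>j=m..<n. r j) \<le> f m * 1"
        using prod_le_1 pos[of m] by (intro mult_left_mono) auto
      also have "\<dots> \<le> C * f (m + ?l)" using len_drop[of m m] by simp
      also have "\<dots> \<le> C * f n" using f_anti[OF True] C by simp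
      finally show ?thesis .
    next
      case far: False
      show ?thesis
      proof (cases "e m \<le> 1/2")
        case True
        then have "f m * r m \<le> f (Suc m)" using half[of m] by (simp add: r_def)
        moreover have "(\<Prod>j=m..<n. r j) = r m * (\<Prod>j=Suc m..<n. r j)"
          using far by (subst prod.atLeast_Suc_lessThan) auto
        ultimately have "f m * (\<Prod>j=m..<n. r j) \<le> f (Suc m) * (\<Prod>j=Suc m..<n. r j)"
          using r(2) by (simp flip: mult.assoc) (intro mult_right_mono prod_nonneg, auto simp: less_imp_le)
        also have "\<dots> \<le> C * f n" using far by (intro less) auto
        finally show ?thesis .
      next
        case False
        have "r j \<le> exp (- ln C / real ?l)" if "j \<in> {m..<m + ?l}" for j
        proof -
          have jm: "len m \<le> len j" using that by (intro len_mono) auto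
          have "len j \<le> 2 * ?l" using len_add[of m "j - m"] that by auto
          then have "e j \<le> exp (- ln C / real ?l)"
            using C len_pos[of j] len_pos[of m]
            by (simp add: e_def field_simps)
          \<comment> \<open>As \<open>len\<close> increases, \<open>e j\<close> stays above 1/2 as
            well, so that \<open>r j = e j\<close>.\<close>
          moreover have "e m \<le> e j"
            using C jm len_pos[of j] len_pos[of m] by (simp add: e_def frac_le)
          ultimately show ?thesis using False by (simp add: r_def)
        qed
        then have "(\<Prod>j=m..<m + ?l. r j) \<le> (\<Prod>j=m..<m + ?l. exp (- ln C / real ?l))"
          using r(2) by (intro prod_mono) (auto simp: less_imp_le)
        also have "\<dots> = 1 / C"
          using len_pos[of m] C by (simp flip: exp_of_nat_mult add: exp_minus field_simps)
        finally have blk: "(\<Prod>j=m..<m + ?l. r j) \<le> 1 / C" .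
        have "(\<Prod>j=m..<n. r j) = (\<Prod>j=m..<m + ?l. r j) * (\<Prod>j=m + ?l..<n. r j)"
          using far by (subst prod.atLeastLessThan_concat) auto
        then have "f m * (\<Prod>j=m..<n. r j) = f m * (\<Prod>j=m..<m + ?l. r j) * (\<Prod>j=m + ?l..<n. r j)"
          by simp
        also have "\<dots> \<le> (C * f (m + ?l)) * (1 / C) * (\<Prod>j=m + ?l..<n. r j)"
          using blk len_drop[of m m] r(2) pos[of m] pos[of "m + ?l"] C
          by (intro mult_right_mono mult_mono prod_nonneg) (auto simp: less_imp_le)
        also have "\<dots> = f (m + ?l) * (\<Prod>j=m + ?l..<n. r j)" using C by simp
        also have "\<dots> \<le> C * f n" using far len_pos[of m] by (intro less) auto
        finally show ?thesis .
      qed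
    qed
  qed
  define q where "q = rec_nat (f 0) (\<lambda>n v. max (f (Suc n)) (v * r n))"
  have q_0: "q 0 = f 0" and q_Suc: "q (Suc n) = max (f (Suc n)) (q n * r n)" for n
    by (simp_all add: q_def)
  have f_le_q: "f n \<le> q n" for n
    by (cases n) (auto simp: q_0 q_Suc)
  have q_pos: "0 < q n" for n
    using pos[of n] f_le_q[of n] by linarith
  \<comment> \<open>Here \<open>m\<close> is the last index up to \<open>n\<close> at which the
    recursion restarted from \<open>f\<close>.\<close>
  have "\<exists>m\<le>n. q n = f m * (\<Prod>j=m..<n. r j)" for n
  proof (induction n)
    case (Suc n)
    then obtain m where m: "m \<le> n" "q n = f m * (\<Prod>j=m..<n. r j)" by blast
    show ?case
    proof (cases "f (Suc n) \<le> q n * r n")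
      case True
      then have "q (Suc n) = f m * (\<Prod>j=m..<Suc n. r j)"
        using m by (simp add: q_Suc max_absorb2 mult_ac)
      with m show ?thesis by (intro exI[of _ m]) auto
    next
      case False
      then show ?thesis by (intro exI[of _ "Suc n"]) (auto simp: q_Suc)
    qed
  qed (auto simp: q_0)
  then have q_le: "q n \<le> C * f n" for n
    using key by metis
  have q_dec: "q (Suc n) \<le> q n" for n
    using order_trans[OF dec f_le_q] mult_left_mono[OF r(3), of "q n" n] q_pos[of n] by (simp add: q_Suc)
  have q_r: "r n * q n \<le> q (Suc n)" for n
    by (simp add: q_Suc mult.commute)
  have q_half: "q n \<le> 2 * q (Suc n)" for n
    using q_r[of n] mult_right_mono[OF r(1)[of n] less_imp_le[OF q_pos[of n]]] by linarith
  have "(\<lambda>n. q (Suc n) / q n) \<longlonglongrightarrow> 1"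
  proof (rule tendsto_sandwich[OF _ _ r_lim tendsto_const])
    show "\<forall>\<^sub>F n in sequentially. r n \<le> q (Suc n) / q n"
      using q_r q_pos by (intro always_eventually allI) (simp add: field_simps)
    show "\<forall>\<^sub>F n in sequentially. q (Suc n) / q n \<le> 1"
      using q_dec q_pos by (intro always_eventually allI) (simp add: field_simps)
  qed
  from that[OF f_le_q q_le q_dec q_half this] show thesis .
qed

text \<open>Each truncated line \<open>q n * min 1 (t * 2 ^ n)\<close> is quasi-concave, and suprema
  preserve this. By \<open>dec\<close> and \<open>half\<close> the supremum equals
  \<open>q n\<close> at \<open>1 / 2 ^ n\<close>. Multiplying the argument by \<open>u\<close>
  shifts the dyadic index by a bounded amount, over which the quotients of \<open>q\<close> tend to
  1.\<close>

lemma quasi_concave_of_slowly_varying_sequence: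
  fixes q :: "nat \<Rightarrow> real"
  assumes pos: "\<And>n. 0 < q n" and dec: "\<And>n. q (Suc n) \<le> q n" and half: "\<And>n. q n \<le> 2 * q (Suc n)"
    and lim: "(\<lambda>n. q (Suc n) / q n) \<longlonglongrightarrow> 1"
  obtains \<psi> where "quasi_concave \<psi>" "regularly_varying_at_zero_of_order_infinity \<psi>"
    "\<And>n t. 1 / 2 ^ Suc n \<le> t \<Longrightarrow> t \<le> 1 / 2 ^ n \<Longrightarrow> q (Suc n) \<le> \<psi> t \<and> \<psi> t \<le> q n"
proof -
  define g where "g n t = q n * min 1 (t * 2 ^ n)" for n and t :: real
  define \<psi> where "\<psi> t = (SUP n. g n t)" for t
  have anti: "q n \<le> q m" if "m \<le> n" for m n
    using dec that by (rule lift_Suc_antimono_le)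
  have g_le: "g n t \<le> q n" for n t
    using pos[of n] by (simp add: g_def mult_le_cancel_left2)
  have up: "g n t \<le> \<psi> t" for n t
    unfolding \<psi>_def using order_trans[OF g_le anti[of 0]]
    by (intro cSUP_upper bdd_aboveI2[of _ _ "q 0"]) auto
  have least: "\<psi> t \<le> M" if "\<And>n. g n t \<le> M" for t M
    unfolding \<psi>_def using that by (intro cSUP_least) auto
  have mono: "\<psi> s \<le> \<psi> t" if "s \<le> t" for s t
    by (rule least, rule order_trans[OF _ up])
       (use that pos in \<open>auto simp: g_def less_imp_le intro!: mult_left_mono min.mono\<close>)
  have qc: "quasi_concave \<psi>"
    unfolding quasi_concave_def
  proof (intro conjI ballI monotone_onI mono)
    show z: "\<psi> 0 = 0" by (simp add: \<psi>_def g_def)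
    fix t :: real assume "t \<in> {0..1}"
    then show "0 \<le> \<psi> t" using mono[of 0 t] z by simp
  next
    fix s t :: real assume st: "s \<in> {0<..1}" "t \<in> {0<..1}" "s \<le> t"
    have "\<psi> t \<le> (t / s) * \<psi> s"
    proof (rule least)
      fix n
      have "min 1 (t * 2 ^ n) \<le> (t / s) * min 1 (s * 2 ^ n)"
      proof (cases "s * 2 ^ n \<le> 1")
        case True
        then show ?thesis using st by (simp add: min_absorb2)
      next
        case False
        then have "min 1 (s * 2 ^ n) = 1" by simp
        then show ?thesis using st by (simp add: min_le_iff_disj field_simps)
      qed
      then have "g n t \<le> (t / s) * g n s"
        using mult_left_mono[of "min 1 (t * 2 ^ n)" "(t / s) * min 1 (s * 2 ^ n)" "q n"] pos[of n]
        by (simp add: g_def mult_ac)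
      also have "\<dots> \<le> (t / s) * \<psi> s"
        using st up by (intro mult_left_mono) auto
      finally show "g n t \<le> (t / s) * \<psi> s" .
    qed
    then show "\<psi> t / t \<le> \<psi> s / s" using st by (simp add: field_simps)
  qed
  have low: "q n \<le> \<psi> t" if "1 / 2 ^ n \<le> t" for n t
  proof -
    have "g n t = q n" using that by (simp add: g_def min_def field_simps)
    then show ?thesis using up by metis
  qed
  have high: "\<psi> t \<le> q n" if "t \<le> 1 / 2 ^ n" for n t
  proof (rule least)
    fix m
    show "g m t \<le> q n"
    proof (cases "m \<le> n")
      case True
      \<comment> \<open>For \<open>m \<le> n\<close> the linear part of \<open>g m\<close>
        contributes at most \<open>1 / 2 ^ k\<close> at \<open>t\<close>, which makes up for
        \<open>q m \<le> 2 ^ k * q n\<close>.\<close>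
      then obtain k where k: "n = m + k" using le_Suc_ex by blast
      have "q m \<le> 2 ^ k * q (m + k)" for k
      proof (induction k)
        case (Suc k)
        have "2 ^ k * q (m + k) \<le> 2 ^ k * (2 * q (Suc (m + k)))"
          by (intro mult_left_mono half) auto
        with Suc have "q m \<le> 2 ^ k * (2 * q (Suc (m + k)))" by linarith
        then show ?case by (simp add: mult_ac)
      qed simp
      then have qm: "q m \<le> 2 ^ k * q n" using k by simp
      have "t * 2 ^ m \<le> 1 / 2 ^ k" using that by (simp add: k power_add field_simps)
      then have "min 1 (t * 2 ^ m) \<le> 1 / 2 ^ k" by (simp add: min_le_iff_disj)
      then have "g m t \<le> q m * (1 / 2 ^ k)"
        unfolding g_def using pos[of m] by (intro mult_left_mono) auto
      also have "\<dots> \<le> q n" using qm by (simp add: field_simps)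
      finally show ?thesis .
    next
      case False
      then show ?thesis using order_trans[OF g_le anti[of n m]] by simp
    qed
  qed
  have lim_k: "(\<lambda>n. q (n + k) / q n) \<longlonglongrightarrow> 1" for k
  proof (induction k)
    case 0
    have "q n \<noteq> 0" for n using pos[of n] by simp
    then show ?case by simp
  next
    case (Suc k)
    have "(\<lambda>n. q (Suc (n + k)) / q (n + k) * (q (n + k) / q n)) \<longlonglongrightarrow> 1 * 1"
      by (intro tendsto_mult Suc LIMSEQ_ignore_initial_segment[OF lim])
    moreover have "q (n + k) \<noteq> 0" for n using pos[of "n + k"] by simp
    ultimately show ?case by simp
  qed
  define N where "N t = (LEAST n. 1 / t < 2 ^ Suc n)" for t :: real
  have N: "1 / 2 ^ Suc (N t) \<le> t" "t \<le> 1 / 2 ^ N t" if "0 < t" "t \<le> 1" for t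
  proof -
    obtain n where "1 / t < (2::real) ^ n" using real_arch_pow[of 2 "1 / t"] by auto
    also have "\<dots> \<le> 2 ^ Suc n" by simp
    finally have "1 / t < 2 ^ Suc (N t)" unfolding N_def by (rule LeastI)
    then show "1 / 2 ^ Suc (N t) \<le> t" using that by (simp add: field_simps)
    show "t \<le> 1 / 2 ^ N t"
    proof (cases "N t")
      case (Suc m)
      then have "\<not> 1 / t < 2 ^ Suc m"
        unfolding N_def by (intro not_less_Least) simp
      then show ?thesis using that Suc by (simp add: field_simps)
    qed (use that in simp)
  qed
  have N_top: "filterlim N at_top (at_right 0)"
    unfolding filterlim_at_top
  proof
    fix Z
    show "\<forall>\<^sub>F t in at_right 0. Z \<le> N t"
      unfolding eventually_at_right_field
    proof (intro exI[of _ "1 / 2 ^ Z"] conjI allI impI)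
      fix t :: real assume t: "0 < t" "t < 1 / 2 ^ Z"
      have "(1::real) / 2 ^ Z \<le> 1" by simp
      with t have "1 / 2 ^ Suc (N t) < 1 / (2::real) ^ Z"
        using N(1)[of t] by linarith
      then have "(2::real) ^ Z < 2 ^ Suc (N t)" by (simp add: field_simps)
      then show "Z \<le> N t" by (simp only: power_strict_increasing_iff)
    qed simp
  qed
  have rv: "regularly_varying_at_zero_of_order_infinity \<psi>"
    unfolding regularly_varying_at_zero_of_order_infinity_def
  proof (intro allI impI)
    fix u :: real assume u: "0 < u"
    \<comment> \<open>A \<open>k\<close> with \<open>1 / 2 ^ k \<le> u \<le> 2 ^ k\<close> bounds
      the shift of the dyadic index when \<open>t\<close> is multiplied by \<open>u\<close>.\<close>
    obtain k1 where "u < 2 ^ k1" using real_arch_pow[of 2 u] by auto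
    moreover obtain k2 where "1 / u < 2 ^ k2" using real_arch_pow[of 2 "1 / u"] by auto
    moreover define k where "k = max k1 k2"
    moreover have "(2::real) ^ k1 \<le> 2 ^ k" "(2::real) ^ k2 \<le> 2 ^ k"
      by (simp_all add: k_def)
    ultimately have k: "u \<le> 2 ^ k" "1 / u \<le> 2 ^ k" by linarith+
    have ev: "\<forall>\<^sub>F t in at_right 0. 0 < t \<and> t \<le> 1 \<and> k \<le> N t"
      using filterlim_at_top[THEN iffD1, OF N_top]
      by (intro eventually_conj) (auto simp: eventually_at_right_field intro: exI[of _ 1])
    have "(\<lambda>n. q (n + Suc k) / q n) \<longlonglongrightarrow> 1" by (rule lim_k)
    then have l1: "((\<lambda>t. q (N t + Suc k) / q (N t)) \<longlongrightarrow> 1) (at_right 0)"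
      by (rule filterlim_compose[OF _ N_top])
    have "(\<lambda>n. inverse (q (n + Suc k) / q n)) \<longlonglongrightarrow> inverse 1"
      by (intro tendsto_inverse lim_k) simp
    then have l0: "(\<lambda>n. inverse (q (n + Suc k) / q n)) \<longlonglongrightarrow> 1" by simp
    have "filterlim (\<lambda>t. N t - k) at_top (at_right 0)"
      by (rule filterlim_compose[OF filterlim_minus_const_nat_at_top N_top])
    \<comment> \<open>The upper bound \<open>q (N t - k) / q (Suc (N t))\<close> is written as an
      inverse based at \<open>N t - k\<close>, so that \<open>lim_k\<close> with distance
      \<open>Suc k\<close> applies; the two agree once \<open>k \<le> N t\<close>.\<close>
    then have l2: "((\<lambda>t. inverse (q (N t - k + Suc k) / q (N t - k))) \<longlongrightarrow> 1) (at_right 0)"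
      by (rule filterlim_compose[OF l0])
    show "((\<lambda>t. \<psi> (t * u) / \<psi> t) \<longlongrightarrow> 1) (at_right 0)"
    proof (rule tendsto_sandwich[OF _ _ l1 l2])
      show "\<forall>\<^sub>F t in at_right 0. q (N t + Suc k) / q (N t) \<le> \<psi> (t * u) / \<psi> t"
        using ev
      proof eventually_elim
        case (elim t)
        have "1 / 2 ^ (N t + Suc k) = (1 / 2 ^ Suc (N t)) * (1 / (2::real) ^ k)"
          by (simp add: power_add)
        also have "\<dots> \<le> t * u"
          using N[of t] elim u k by (intro mult_mono) (auto simp: field_simps)
        finally have "q (N t + Suc k) \<le> \<psi> (t * u)" by (rule low)
        moreover have "\<psi> t \<le> q (N t)" "0 < \<psi> t"
          using N[of t] elim high low[of "Suc (N t)" t] pos[of "Suc (N t)"] by auto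
        ultimately show ?case using pos[of "N t + Suc k"] by (intro frac_le) auto
      qed
      show "\<forall>\<^sub>F t in at_right 0. \<psi> (t * u) / \<psi> t \<le> inverse (q (N t - k + Suc k) / q (N t - k))"
        using ev
      proof eventually_elim
        case (elim t)
        have "t * u \<le> (1 / 2 ^ N t) * 2 ^ k"
          using N[of t] elim u k by (intro mult_mono) auto
        also have "\<dots> = 1 / 2 ^ (N t - k)"
          using elim by (simp add: power_diff)
        finally have "\<psi> (t * u) \<le> q (N t - k)" by (rule high)
        moreover have "q (Suc (N t)) \<le> \<psi> t" using N[of t] elim low by auto
        ultimately have "\<psi> (t * u) / \<psi> t \<le> q (N t - k) / q (Suc (N t))"
          using pos[of "N t - k"] pos[of "Suc (N t)"] by (intro frac_le) auto
        then show ?case using elim by simp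
      qed
    qed
  qed
  show thesis by (rule that[OF qc rv]) (use low high in blast)
qed

text \<open>\<open>\<phi>\<close> is sampled at the points \<open>1 / 2 ^ n\<close>, majorised by a
  slowly varying sequence and interpolated. Bounded dilations with factor \<open>2 ^ L\<close>
  provide the hypothesis on drops over \<open>L\<close> indices.\<close>

lemma (in fundamental_function) equivalent_slowly_varying_if_bounded_dilations:
  assumes "has_bounded_dilations \<phi>"
  shows "\<exists>\<psi>. quasi_concave \<psi> \<and> regularly_varying_at_zero_of_order_infinity \<psi> \<and>
    equivalent_functions \<phi> \<psi>"
proof -
  obtain C0 where C0: "\<And>n::nat. \<exists>\<delta>>0. \<forall>t. 0 < t \<and> t \<le> \<delta> \<and> t \<le> 1 \<longrightarrow>
      \<phi> (min 1 (real n * t)) \<le> C0 * \<phi> t"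
    using assms unfolding has_bounded_dilations_def by blast
  \<comment> \<open>The majorant sequence asks for a constant of at least 2.\<close>
  define C where "C = max 2 C0"
  define f where "f n = \<phi> (1 / 2 ^ n)" for n :: nat
  have f_pos: "0 < f n" for n unfolding f_def by (rule pos) auto
  have "f (Suc n) \<le> f n" for n unfolding f_def by (rule mono) (auto simp: field_simps)
  moreover have f_half: "f n \<le> 2 * f (Suc n)" for n
  proof -
    have "1 \<le> 2 * (2::real) ^ n" by (rule order_trans[of _ "2 ^ n"]) auto
    then show ?thesis unfolding f_def by (intro dilation_le) (auto simp: field_simps)
  qed
  moreover have "2 \<le> C" by (simp add: C_def)
  moreover have "\<exists>m. \<forall>n\<ge>m. f n \<le> C * f (n + L)" for L
  proof -
    obtain \<delta> where \<delta>: "0 < \<delta>" "\<And>t. 0 < t \<Longrightarrow> t \<le> \<delta> \<Longrightarrow> t \<le> 1 \<Longrightarrow>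
        \<phi> (min 1 (real (2 ^ L) * t)) \<le> C0 * \<phi> t"
      using C0[of "2 ^ L"] by blast
    obtain m where m: "1 / \<delta> < 2 ^ m" using real_arch_pow[of 2 "1 / \<delta>"] by auto
    have "f n \<le> C * f (n + L)" if "m \<le> n" for n
    proof -
      have "(2::real) ^ m \<le> 2 ^ (n + L)" using that by (intro power_increasing) auto
      with m have "1 / \<delta> < 2 ^ (n + L)" by linarith
      then have "1 / 2 ^ (n + L) \<le> \<delta>" using \<delta>(1) by (simp add: field_simps)
      from \<delta>(2)[OF _ this] have "\<phi> (min 1 (2 ^ L * (1 / 2 ^ (n + L)))) \<le> C0 * f (n + L)"
        by (simp add: f_def)
      also have "min 1 (2 ^ L * (1 / 2 ^ (n + L))) = (1::real) / 2 ^ n"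
        by (simp add: power_add)
      also have "C0 * f (n + L) \<le> C * f (n + L)"
        using f_pos[of "n + L"] by (intro mult_right_mono) (auto simp: C_def)
      finally show ?thesis by (simp add: f_def)
    qed
    then show ?thesis by blast
  qed
  ultimately obtain q where q: "\<And>n. f n \<le> q n" "\<And>n. q n \<le> C * f n" "\<And>n. q (Suc n) \<le> q n"
    "\<And>n. q n \<le> 2 * q (Suc n)" "(\<lambda>n. q (Suc n) / q n) \<longlonglongrightarrow> 1"
    using slowly_varying_majorant_sequence[of f C, OF f_pos] by blast
  have q_pos: "0 < q n" for n using f_pos[of n] q(1)[of n] by linarith
  obtain \<psi> where \<psi>: "quasi_concave \<psi>" "regularly_varying_at_zero_of_order_infinity \<psi>"
    "\<And>n t. 1 / 2 ^ Suc n \<le> t \<Longrightarrow> t \<le> 1 / 2 ^ n \<Longrightarrow> q (Suc n) \<le> \<psi> t \<and> \<psi> t \<le> q n"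
    using quasi_concave_of_slowly_varying_sequence[OF q_pos q(3-5)] by blast
  \<comment> \<open>On a dyadic interval each function stays between consecutive members of its
    sequence, which differ by a factor of at most 2; \<open>C\<close> comes from
    \<open>q n \<le> C * f n\<close>.\<close>
  have both: "\<phi> t \<le> 2 * \<psi> t \<and> \<psi> t \<le> (2 * C) * \<phi> t" if t: "t \<in> {0..1}" for t
  proof (cases "t = 0")
    case True
    then show ?thesis using \<psi>(1) by (simp add: quasi_concave_def)
  next
    case False
    obtain n0 where n0: "1 / t < 2 ^ n0" using real_arch_pow[of 2 "1 / t"] by auto
    define n where "n = (LEAST n. 1 / t < 2 ^ n)"
    have n: "1 / t < 2 ^ n" unfolding n_def using n0 by (rule LeastI)
    have "n \<noteq> 0" using n t False by (intro notI) (simp add: field_simps)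
    then obtain k where k: "n = Suc k" by (cases n) auto
    have "\<not> 1 / t < 2 ^ k" using k unfolding n_def by (intro not_less_Least) simp
    then have tk: "1 / 2 ^ Suc k \<le> t" "t \<le> 1 / 2 ^ k"
      using n k t False by (auto simp: field_simps)
    have \<psi>t: "q (Suc k) \<le> \<psi> t" "\<psi> t \<le> q k" using \<psi>(3)[OF tk] by auto
    have a: "\<phi> t \<le> f k" "f (Suc k) \<le> \<phi> t"
      unfolding f_def using tk t by (auto intro!: mono)
    have "\<phi> t \<le> 2 * \<psi> t" using a(1) f_half[of k] q(1)[of "Suc k"] \<psi>t(1) by linarith
    moreover have "\<psi> t \<le> 2 * (C * f (Suc k))"
      using \<psi>t(2) q(4)[of k] q(2)[of "Suc k"] by linarith
    then have "\<psi> t \<le> (2 * C) * \<phi> t"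
      using mult_left_mono[OF a(2), of "2 * C"] by (simp add: C_def)
    ultimately show ?thesis ..
  qed
  have "equivalent_functions \<phi> \<psi>"
    unfolding equivalent_functions_def
  proof
    show "\<exists>C>0. \<forall>t\<in>{0..1}. \<phi> t \<le> C * \<psi> t"
      using both by (intro exI[of _ 2]) auto
    show "\<exists>C>0. \<forall>t\<in>{0..1}. \<psi> t \<le> C * \<phi> t"
      using both by (intro exI[of _ "2 * C"]) (auto simp: C_def)
  qed
  with \<psi> show ?thesis by blast
qed

section \<open>Sums of functions with separated supports\<close>

lemma distribution_function_le_measure:
  assumes "AE s in lebesgue. s \<in> {0..1} \<longrightarrow> l < \<bar>x s\<bar> \<longrightarrow> s \<in> B" and B: "B \<in> lmeasurable"
  shows "distribution_function x l \<le> measure lebesgue B"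
proof -
  have "ennreal (distribution_function x l) \<le> emeasure lebesgue B"
    unfolding emeasure_eq_distribution_function[symmetric]
    using assms by (intro emeasure_mono_AE) auto
  also have "\<dots> = ennreal (measure lebesgue B)"
    using B by (simp add: emeasure_eq_measure2)
  finally show ?thesis by simp
qed

lemma sum_eq_single:
  fixes f :: "'i \<Rightarrow> 'a::comm_monoid_add"
  assumes "finite I" "k \<in> I" "\<And>i. i \<in> I \<Longrightarrow> i \<noteq> k \<Longrightarrow> f i = 0"
  shows "sum f I = f k"
  using assms by (simp add: sum.remove[of I k] sum.neutral)

text \<open>At almost every point at most one summand is nonzero. Those with index above
  \<open>m\<close> live in \<open>{0..c}\<close>, so they add at most \<open>c\<close> whatever
  their number. With \<open>m = n\<close> and \<open>c = 0\<close> this is plain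
  subadditivity.\<close>

lemma distribution_function_disjoint_sum_le:
  fixes z :: "nat \<Rightarrow> real \<Rightarrow> real"
  assumes z: "\<And>i. i \<in> {1..n} \<Longrightarrow> z i \<in> borel_measurable (lebesgue_on {0..1})"
    and disj: "AE s in lebesgue. s \<in> {0..1} \<longrightarrow> (\<forall>i\<in>{1..n}. \<forall>j\<in>{1..n}. i \<noteq> j \<longrightarrow> z i s = 0 \<or> z j s = 0)"
    and tail: "AE s in lebesgue. s \<in> {0..1} \<longrightarrow> (\<forall>i\<in>{1..n}. m < i \<longrightarrow> z i s \<noteq> 0 \<longrightarrow> s \<le> c)"
    and c: "0 \<le> c" and l: "0 < l"
  shows "distribution_function (\<lambda>s. \<Sum>i=1..n. z i s) l \<le> (\<Sum>i=1..min n m. distribution_function (z i) l) + c"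
proof -
  let ?A = "\<lambda>i. {s\<in>{0..1}. l < \<bar>z i s\<bar>}"
  have A: "?A i \<in> lmeasurable" if "i \<in> {1..min n m}" for i
    using that by (intro superlevel_fmeasurable z) auto
  have "distribution_function (\<lambda>s. \<Sum>i=1..n. z i s) l \<le> measure lebesgue ((\<Union>i\<in>{1..min n m}. ?A i) \<union> {0..c})"
  proof (rule distribution_function_le_measure)
    show "AE s in lebesgue. s \<in> {0..1} \<longrightarrow> l < \<bar>\<Sum>i=1..n. z i s\<bar> \<longrightarrow>
        s \<in> (\<Union>i\<in>{1..min n m}. ?A i) \<union> {0..c}"
      using disj tail
    proof eventually_elim
      case (elim s)
      show ?case
      proof (intro impI)
        assume s: "s \<in> {0..1}" "l < \<bar>\<Sum>i=1..n. z i s\<bar>"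
        with l have "(\<Sum>i=1..n. z i s) \<noteq> 0" by auto
        then obtain k where k: "k \<in> {1..n}" "z k s \<noteq> 0" by (meson sum.not_neutral_contains_not_neutral)
        have "(\<Sum>i=1..n. z i s) = z k s"
        proof (rule sum_eq_single)
          show "z i s = 0" if "i \<in> {1..n}" "i \<noteq> k" for i
            using elim(1) s k that by blast
        qed (use k in auto)
        then show "s \<in> (\<Union>i\<in>{1..min n m}. ?A i) \<union> {0..c}"
          using elim(2) s k by (cases "m < k") auto
      qed
    qed
    show "(\<Union>i\<in>{1..min n m}. ?A i) \<union> {0..c} \<in> lmeasurable"
      using A by (intro fmeasurable.Un fmeasurable.finite_UN) auto
  qed
  also have "\<dots> \<le> measure lebesgue (\<Union>i\<in>{1..min n m}. ?A i) + measure lebesgue {0..c}"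
    using A by (intro measure_Un_le fmeasurableD fmeasurable.finite_UN) auto
  also have "measure lebesgue (\<Union>i\<in>{1..min n m}. ?A i) \<le> (\<Sum>i=1..min n m. measure lebesgue (?A i))"
    using A by (intro measure_UNION_le fmeasurableD) auto
  finally show ?thesis
    using c by (simp add: distribution_function_def)
qed

text \<open>Lower estimate: almost everywhere the sum agrees with \<open>z k\<close> where
  \<open>z k\<close> is nonzero.\<close>

lemma distribution_function_le_disjoint_sum:
  fixes z :: "nat \<Rightarrow> real \<Rightarrow> real"
  assumes z: "\<And>i. i \<in> {1..n} \<Longrightarrow> z i \<in> borel_measurable (lebesgue_on {0..1})"
    and disj: "AE s in lebesgue. s \<in> {0..1} \<longrightarrow> (\<forall>i\<in>{1..n}. \<forall>j\<in>{1..n}. i \<noteq> j \<longrightarrow> z i s = 0 \<or> z j s = 0)"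
    and k: "k \<in> {1..n}" and l: "0 < l"
  shows "distribution_function (z k) l \<le> distribution_function (\<lambda>s. \<Sum>i=1..n. z i s) l"
proof -
  have "distribution_function (z k) l \<le> measure lebesgue {s\<in>{0..1}. l < \<bar>\<Sum>i=1..n. z i s\<bar>}"
  proof (rule distribution_function_le_measure)
    show "AE s in lebesgue. s \<in> {0..1} \<longrightarrow> l < \<bar>z k s\<bar> \<longrightarrow> s \<in> {s\<in>{0..1}. l < \<bar>\<Sum>i=1..n. z i s\<bar>}"
      using disj
    proof eventually_elim
      case (elim s)
      show ?case
      proof (intro impI)
        assume s: "s \<in> {0..1}" "l < \<bar>z k s\<bar>"
        with l have "z k s \<noteq> 0" by auto
        have "(\<Sum>i=1..n. z i s) = z k s"
        proof (rule sum_eq_single)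
          show "z i s = 0" if "i \<in> {1..n}" "i \<noteq> k" for i
            using elim s k \<open>z k s \<noteq> 0\<close> that by blast
        qed (use k in auto)
        with s show "s \<in> {s\<in>{0..1}. l < \<bar>\<Sum>i=1..n. z i s\<bar>}" by simp
      qed
    qed
    show "{s\<in>{0..1}. l < \<bar>\<Sum>i=1..n. z i s\<bar>} \<in> lmeasurable"
      using z by (intro superlevel_fmeasurable borel_measurable_sum) auto
  qed
  then show ?thesis by (simp add: distribution_function_def)
qed

text \<open>The number of summands that matter at scale \<open>s\<close> is governed by the
  \<open>j\<close> with \<open>c (Suc j) < s \<le> c j\<close>, and \<open>dil\<close> absorbs this
  number, so that the constant does not depend on \<open>n\<close>.\<close>

lemma (in fundamental_function) weak_estimate_disjoint_sum:
  fixes z :: "nat \<Rightarrow> real \<Rightarrow> real" and c :: "nat \<Rightarrow> real"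
  assumes c: "c 0 = 1" "\<And>j. 0 < c j" "\<And>j. c (Suc j) \<le> c j / 2"
    and dil: "\<And>j s. 0 < s \<Longrightarrow> s \<le> c j \<Longrightarrow> \<phi> (min 1 (real (j + 2) * s)) \<le> C * \<phi> s"
    and C: "0 \<le> C" and n: "1 \<le> n"
    and z: "\<And>i. i \<in> {1..n} \<Longrightarrow> z i \<in> borel_measurable (lebesgue_on {0..1})"
    and disj: "AE s in lebesgue. s \<in> {0..1} \<longrightarrow> (\<forall>i\<in>{1..n}. \<forall>j\<in>{1..n}. i \<noteq> j \<longrightarrow> z i s = 0 \<or> z j s = 0)"
    and supp: "AE s in lebesgue. s \<in> {0..1} \<longrightarrow> (\<forall>i\<in>{1..n}. z i s \<noteq> 0 \<longrightarrow> s \<le> c (i - 1))"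
    and V: "0 \<le> V" "\<And>i l. i \<in> {1..n} \<Longrightarrow> 0 < l \<Longrightarrow> l * \<phi> (distribution_function (z i) l) \<le> V"
    and l: "0 < l"
  shows "l * \<phi> (distribution_function (\<lambda>s. \<Sum>i=1..n. z i s) l) \<le> C * V"
proof -
  let ?D = "distribution_function (\<lambda>s. \<Sum>i=1..n. z i s) l"
  let ?d = "\<lambda>i. distribution_function (z i) l"
  have c_anti: "c j \<le> c i" if "i \<le> j" for i j
    by (rule lift_Suc_antimono_le[OF _ that]) (use c(2,3) in \<open>smt (verit) field_sum_of_halves\<close>)
  have c_le: "c j \<le> 1 / 2 ^ j" for j
  proof (induction j)
    case (Suc j)
    have "c (Suc j) \<le> (1 / 2 ^ j) / 2" by (rule order_trans[OF c(3) divide_right_mono[OF Suc]]) simp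
    then show ?case by (simp add: field_simps)
  qed (simp add: c)
  show ?thesis
  proof (cases "?D = 0")
    case False
    then have D: "0 < ?D" by (simp add: less_le)
    define s where "s = Max (?d ` {1..n})"
    have "s \<in> ?d ` {1..n}" unfolding s_def using n by (intro Max_in) auto
    then obtain k where k: "k \<in> {1..n}" "s = ?d k" by auto
    have s_max: "?d i \<le> s" if "i \<in> {1..n}" for i
      unfolding s_def using that by (intro Max_ge) auto
    have "s \<noteq> 0"
    proof
      assume "s = 0"
      have "?D \<le> (\<Sum>i=1..min n n. ?d i) + 0"
        using z disj by (rule distribution_function_disjoint_sum_le) (use l in auto)
      also have "\<dots> \<le> (\<Sum>i=1..min n n. 0) + 0"
        using s_max \<open>s = 0\<close> by (intro add_mono sum_mono) auto
      finally show False using D by simp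
    qed
    then have s: "0 < s" "s \<le> 1" using k by (auto simp: less_le distribution_function_le_1)
    obtain j0 where "1 / s < 2 ^ j0" using real_arch_pow[of 2 "1 / s"] by auto
    then have "1 / 2 ^ j0 < s" using s by (simp add: field_simps)
    then have j0: "c (Suc j0) < s" using c_le[of j0] c_anti[of j0 "Suc j0"] by simp
    \<comment> \<open>Minimality gives \<open>s \<le> c j\<close>; for \<open>j = 0\<close> this is
      \<open>c 0 = 1\<close>.\<close>
    define j where "j = (LEAST j. c (Suc j) < s)"
    have j: "c (Suc j) < s" unfolding j_def using j0 by (rule LeastI)
    have sj: "s \<le> c j"
    proof (cases j)
      case (Suc i)
      then have "\<not> c (Suc i) < s" unfolding j_def by (intro not_less_Least) simp
      then show ?thesis by (simp add: Suc)
    qed (simp add: s c)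
    \<comment> \<open>The support bound is shifted: \<open>z i\<close> lives below
      \<open>c (i - 1)\<close>, so all indices above \<open>Suc j\<close> fit into
      \<open>{0..c (Suc j)}\<close>, which is shorter than \<open>s\<close>. Together with
      \<open>Suc j\<close> terms of size at most \<open>s\<close> this gives the factor
      \<open>j + 2\<close>.\<close>
    have "?D \<le> (\<Sum>i=1..min n (Suc j). ?d i) + c (Suc j)"
    proof (rule distribution_function_disjoint_sum_le[OF z disj])
      show "AE s in lebesgue. s \<in> {0..1} \<longrightarrow> (\<forall>i\<in>{1..n}. Suc j < i \<longrightarrow> z i s \<noteq> 0 \<longrightarrow> s \<le> c (Suc j))"
        using supp
      proof eventually_elim
        case (elim s)
        then show ?case
          using order_trans[OF _ c_anti[of "Suc j" "_ - 1"]] by fastforce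
      qed
    qed (use c(2)[of "Suc j"] l in auto)
    also have "\<dots> \<le> (\<Sum>i=1..min n (Suc j). s) + s"
      using s_max j by (intro add_mono sum_mono) auto
    also have "\<dots> \<le> real (Suc j) * s + s"
      using s by (intro add_right_mono) (auto intro!: mult_right_mono simp: min_def)
    also have "\<dots> = real (j + 2) * s" by (simp add: algebra_simps)
    finally have "?D \<le> min 1 (real (j + 2) * s)" by (simp add: distribution_function_le_1)
    then have "\<phi> ?D \<le> \<phi> (min 1 (real (j + 2) * s))"
      using s by (intro mono) auto
    also have "\<dots> \<le> C * \<phi> s" using s(1) sj by (rule dil)
    finally have "l * \<phi> ?D \<le> l * (C * \<phi> s)" using l by simp
    also have "\<dots> = C * (l * \<phi> (?d k))" by (simp add: k)
    also have "\<dots> \<le> C * V" using V(2)[OF k(1) l] C by (rule mult_left_mono)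
    finally show ?thesis .
  qed (use C V in simp)
qed

section \<open>Separation of supports by a weight\<close>

text \<open>Since \<open>w\<close> is positive and each \<open>S i\<close> is non-null, the
  essential suprema \<open>a i\<close> are positive reals. Then \<open>2 * a (i + 1) \<le> w\<close>
  almost everywhere on \<open>S i\<close> separates it strictly from all later sets, and repeated
  halving, starting from \<open>w \<le> 1\<close>, gives the powers of 1/2.\<close>

lemma separated_supports:
  fixes S :: "nat \<Rightarrow> real set"
  assumes w: "w \<in> borel_measurable (lebesgue_on {0..1})" "AE s in lebesgue_on {0..1}. 0 < w s"
      "\<And>s. w s \<le> 1"
    and S: "\<And>i. i \<in> {1..n} \<Longrightarrow> S i \<in> sets lebesgue" "\<And>i. i \<in> {1..n} \<Longrightarrow> S i \<subseteq> {0..1}"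
    and nonnull: "\<And>i. i \<in> {1..n} \<Longrightarrow> \<not> (AE s in lebesgue. s \<notin> S i)"
    and sep: "\<And>i. i \<in> {1..<n} \<Longrightarrow> 2 * sup_on w (S (i + 1)) \<le> inf_on w (S i)"
  obtains "AE s in lebesgue. \<forall>i\<in>{1..n}. s \<in> S i \<longrightarrow> w s \<le> (1/2) ^ (i - 1)"
    "AE s in lebesgue. \<forall>i\<in>{1..n}. \<forall>j\<in>{1..n}. i \<noteq> j \<longrightarrow> s \<notin> S i \<or> s \<notin> S j"
proof -
  have wpos: "AE s in lebesgue. s \<in> {0..1} \<longrightarrow> 0 < w s"
    using w(2) by (simp add: AE_restrict_space_iff)
  have sup_AE: "AE s in lebesgue. s \<in> S i \<longrightarrow> ereal (w s) \<le> sup_on w (S i)" if "i \<in> {1..n}" for i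
    using esssup_AE[of "\<lambda>s. ereal (w s)" "lebesgue_on (S i)"] S(1)[OF that]
    by (simp add: sup_on_def AE_restrict_space_iff)
  have inf_AE: "AE s in lebesgue. s \<in> S i \<longrightarrow> inf_on w (S i) \<le> ereal (w s)" if "i \<in> {1..n}" for i
    using esssup_AE[of "\<lambda>s. - ereal (w s)" "lebesgue_on (S i)"] S(1)[OF that]
    by (simp add: inf_on_def AE_restrict_space_iff ereal_uminus_le_reorder)
  have basic: "0 < sup_on w (S i)" "sup_on w (S i) \<le> 1" "inf_on w (S i) \<le> sup_on w (S i)" if i: "i \<in> {1..n}" for i
  proof -
    \<comment> \<open>A non-null set has a point outside the exceptional null sets of the three
      almost everywhere bounds.\<close>
    have "\<exists>s. s \<in> S i \<and> 0 < w s \<and> ereal (w s) \<le> sup_on w (S i) \<and> inf_on w (S i) \<le> ereal (w s)"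
    proof (rule ccontr)
      assume *: "\<not> ?thesis"
      have "AE s in lebesgue. s \<notin> S i"
        using wpos sup_AE[OF i] inf_AE[OF i]
      proof eventually_elim
        case (elim s)
        then show ?case using * S(2)[OF i] by blast
      qed
      with nonnull[OF i] show False ..
    qed
    then obtain s where s: "0 < ereal (w s)" "ereal (w s) \<le> sup_on w (S i)" "inf_on w (S i) \<le> ereal (w s)"
      by auto
    show "0 < sup_on w (S i)" using s by (metis less_le_trans)
    show "inf_on w (S i) \<le> sup_on w (S i)" using s by (metis order_trans)
    have "w \<in> borel_measurable (lebesgue_on (S i))"
      using measurable_restrict_mono[OF w(1) S(2)[OF i]] .
    then show "sup_on w (S i) \<le> 1"
      unfolding sup_on_def using w(3) by (intro esssup_I) auto
  qed
  define a where "a i = real_of_ereal (sup_on w (S i))" for i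
  have a: "sup_on w (S i) = ereal (a i)" "0 < a i" "a i \<le> 1" if "i \<in> {1..n}" for i
  proof -
    show *: "sup_on w (S i) = ereal (a i)"
      unfolding a_def using basic[OF that] by (cases "sup_on w (S i)") auto
    show "0 < a i" "a i \<le> 1" using basic(1,2)[OF that] by (auto simp: *)
  qed
  have inf_ge: "ereal (2 * a (i + 1)) \<le> inf_on w (S i)" if "i \<in> {1..<n}" for i
    using sep[OF that] a(1)[of "i + 1"] that by simp
  have step: "2 * a (i + 1) \<le> a i" if "i \<in> {1..<n}" for i
    using order_trans[OF inf_ge[OF that] basic(3)[of i]] a(1)[of i] that by simp
  have a_anti: "a j \<le> a i" if "i \<le> j" "1 \<le> i" "j \<le> n" for i j
    using that
  proof (induction j rule: dec_induct)
    case (step j)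
    then show ?case using step a(2)[of "j + 1"] \<open>\<And>i. i \<in> {1..<n} \<Longrightarrow> 2 * a (i + 1) \<le> a i\<close>[of j] by auto
  qed simp
  have a_pow: "a (Suc i) \<le> (1/2) ^ i" if "Suc i \<le> n" for i
    using that
  proof (induction i)
    case 0
    then show ?case using a(3)[of 1] by simp
  next
    case (Suc i)
    then show ?case using step[of "Suc i"] by simp
  qed
  have all: "AE s in lebesgue. \<forall>i\<in>{1..n}. s \<in> S i \<longrightarrow> w s \<le> a i \<and> (i < n \<longrightarrow> 2 * a (i + 1) \<le> w s)"
  proof (rule AE_finite_allI)
    fix i assume i: "i \<in> {1..n}"
    show "AE s in lebesgue. s \<in> S i \<longrightarrow> w s \<le> a i \<and> (i < n \<longrightarrow> 2 * a (i + 1) \<le> w s)"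
      using sup_AE[OF i] inf_AE[OF i]
    proof eventually_elim
      case (elim s)
      have "2 * a (i + 1) \<le> w s" if "s \<in> S i" "i < n"
        using order_trans[OF inf_ge[of i], of "ereal (w s)"] elim that i by simp
      with elim a(1)[OF i] show ?case by simp
    qed
  qed simp
  show thesis
  proof
    show "AE s in lebesgue. \<forall>i\<in>{1..n}. s \<in> S i \<longrightarrow> w s \<le> (1/2) ^ (i - 1)"
      using all
    proof eventually_elim
      case (elim s)
      show ?case
      proof (intro ballI impI)
        fix i assume i: "i \<in> {1..n}" "s \<in> S i"
        then have "w s \<le> a (Suc (i - 1))" using elim by auto
        also have "\<dots> \<le> (1/2) ^ (i - 1)" using i by (intro a_pow) auto
        finally show "w s \<le> (1/2) ^ (i - 1)" .
      qed
    qed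
    show "AE s in lebesgue. \<forall>i\<in>{1..n}. \<forall>j\<in>{1..n}. i \<noteq> j \<longrightarrow> s \<notin> S i \<or> s \<notin> S j"
      using all
    proof eventually_elim
      case (elim s)
      have "\<not> (s \<in> S i \<and> s \<in> S j)" if "i \<in> {1..n}" "j \<in> {1..n}" "i < j" for i j
      proof
        assume "s \<in> S i \<and> s \<in> S j"
        with elim that have "w s \<le> a j" "2 * a (i + 1) \<le> w s" by auto
        moreover have "a j \<le> a (i + 1)" "0 < a (i + 1)" using that by (auto intro!: a_anti a(2))
        ultimately show False by linarith
      qed
      then show ?case by (metis nat_neq_iff)
    qed
  qed
qed

lemma sets_supp:
  assumes "x \<in> borel_measurable (lebesgue_on {0..1})"
  shows "supp x \<in> sets lebesgue"
proof -
  have "{s\<in>{0..1}. 0 < \<bar>x s\<bar>} \<in> sets lebesgue"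
    using assms by (rule superlevel_sets_lebesgue)
  then show ?thesis by (simp add: supp_def)
qed

lemma AE_unit_interval_iff:
  "(AE s in lebesgue_on {0..1}. P s) \<longleftrightarrow> (AE s in lebesgue. s \<in> {0..1::real} \<longrightarrow> P s)"
  by (simp add: AE_restrict_space_iff)

lemma nonzero_function_iff: "nonzero_function x \<longleftrightarrow> \<not> (AE s in lebesgue. s \<notin> supp x)"
proof -
  have "(AE s in lebesgue_on {0..1}. x s = 0) \<longleftrightarrow> (AE s in lebesgue. s \<notin> supp x)"
    unfolding AE_unit_interval_iff
    by (intro AE_cong) (auto simp: supp_def)
  then show ?thesis by (simp add: nonzero_function_def)
qed

text \<open>The weight is the step function with value \<open>(1/2) ^ j\<close> on
  \<open>(c (Suc j), c j]\<close>. Monotonicity gives measurability, and \<open>1 / w\<close> is at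
  least \<open>2 ^ j\<close> on \<open>{0<..c j}\<close>, a set of positive measure.\<close>

lemma rapidly_decreasing_weight:
  fixes c :: "nat \<Rightarrow> real"
  assumes c: "c 0 = 1" "\<And>j. 0 < c j" "\<And>j. c (Suc j) \<le> c j" "c \<longlonglongrightarrow> 0"
  obtains w where "nontrivial_weight w" "\<And>s. w s \<le> 1"
    "\<And>s j. s \<in> {0..1} \<Longrightarrow> w s \<le> (1/2) ^ j \<Longrightarrow> s \<le> c j"
proof -
  have c_anti: "c j \<le> c i" if "i \<le> j" for i j
    using c(3) that by (rule lift_Suc_antimono_le)
  define k where "k s = (LEAST j. c (Suc j) < s)" for s
  \<comment> \<open>The value 0 for \<open>s \<le> 0\<close> keeps \<open>w\<close> monotone on the
    whole line; within \<open>{0..1}\<close> it is taken only at 0.\<close>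
  define w :: "real \<Rightarrow> real" where "w s = (if s \<le> 0 then 0 else (1/2) ^ k s)" for s
  have k: "c (Suc (k s)) < s" if s: "0 < s" for s
  proof -
    have "\<forall>\<^sub>F j in sequentially. c j < s"
      using c(4) s by (rule order_tendstoD)
    then obtain j where "\<forall>i\<ge>j. c i < s" by (auto simp: eventually_sequentially)
    then have "c (Suc j) < s" by simp
    then show ?thesis unfolding k_def by (rule LeastI)
  qed
  have k_le: "k s \<le> j" if "c (Suc j) < s" for s j
    unfolding k_def using that by (rule Least_le)
  have "mono w"
  proof (rule monoI)
    fix s t :: real assume st: "s \<le> t"
    show "w s \<le> w t"
    proof (cases "0 < s")
      case True
      then have "k t \<le> k s" using k[OF True] st by (intro k_le) auto
      then show ?thesis using True st by (simp add: w_def power_decreasing)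
    qed (simp add: w_def)
  qed
  then have "w \<in> borel_measurable lborel" using borel_measurable_mono by simp
  then have meas: "w \<in> borel_measurable (lebesgue_on {0..1})"
    by (intro measurable_restrict_space1 measurable_completion)
  have "AE s in lebesgue. s \<noteq> (0::real)"
    by (rule AE_not_in[of "{0}", simplified]) (simp add: null_sets_completionI)
  then have "AE s in lebesgue_on {0..1}. 0 < w s"
    unfolding AE_unit_interval_iff
    by eventually_elim (auto simp: w_def)
  with meas have "weight w" by (simp add: weight_def)
  moreover have "\<not> essentially_bounded_above (\<lambda>s. 1 / w s)"
  proof
    assume "essentially_bounded_above (\<lambda>s. 1 / w s)"
    then obtain K where "AE s in lebesgue_on {0..1}. 1 / w s \<le> K"
      unfolding essentially_bounded_above_def by blast
    then have K: "AE s in lebesgue. s \<in> {0..1} \<longrightarrow> 1 / w s \<le> K"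
      unfolding AE_unit_interval_iff by simp
    obtain j where j: "K < 2 ^ j" using real_arch_pow[of 2 K] by auto
    have "AE s in lebesgue. s \<notin> {0<..c j}"
      using K
    proof eventually_elim
      case (elim s)
      show ?case
      proof
        assume s: "s \<in> {0<..c j}"
        then have "c (Suc (k s)) < c j" using k[of s] by simp
        then have "j \<le> k s" using c_anti[of "Suc (k s)" j] by (metis not_le not_less_eq_eq)
        then have "(2::real) ^ j \<le> 2 ^ k s" by simp
        also have "\<dots> = 1 / w s" using s by (simp add: w_def power_one_over)
        also have "\<dots> \<le> K" using elim s c_anti[of 0 j] c(1) by simp
        finally show False using j by simp
      qed
    qed
    then have "emeasure lebesgue {0<..c j} = 0"
      by (subst (asm) AE_iff_measurable[where N="{0<..c j}"]) auto
    then show False using c(2)[of j] by simp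
  qed
  ultimately have "nontrivial_weight w" by (simp add: nontrivial_weight_def)
  moreover have "w s \<le> 1" for s by (simp add: w_def power_le_one)
  moreover have "s \<le> c j" if "s \<in> {0..1}" "w s \<le> (1/2) ^ j" for s j
  proof (cases "0 < s")
    case True
    then have "(1/2::real) ^ k s \<le> (1/2) ^ j" using that by (simp add: w_def)
    then have "j \<le> k s" by (subst (asm) power_decreasing_iff) auto
    show ?thesis
    proof (rule ccontr)
      assume *: "\<not> s \<le> c j"
      show False
      proof (cases j)
        case 0
        with * that c(1) show False by simp
      next
        case (Suc i)
        with * have "k s \<le> i" by (intro k_le) simp
        with Suc \<open>j \<le> k s\<close> show False by simp
      qed
    qed
  qed (use that c(2)[of j] in simp)
  ultimately show thesis using that by blast
qed

section \<open>From bounded dilations to decomposability\<close>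

text \<open>With \<open>V\<close> the largest of the common norms, both sums have norm between
  \<open>V\<close> and \<open>M * V\<close>: the lower bound holds since the sum dominates each
  summand, the upper one by \<open>weak_estimate_disjoint_sum\<close> and
  \<open>enorm_le_weak\<close>.\<close>

lemma (in fundamental_function) decomposable_if_bounded_dilations:
  assumes T: "1 < T" and \<kappa>: "0 < \<kappa>" "\<kappa> < 1"
    and contr: "\<And>s. 0 < s \<Longrightarrow> s * T \<le> 1 \<Longrightarrow> \<phi> (s * T) \<le> \<kappa> * T * \<phi> s"
    and "has_bounded_dilations \<phi>"
  shows "\<exists>w. nontrivial_weight w \<and> decomposable w (marcinkiewicz_space \<phi>) (marcinkiewicz_norm \<phi>)"
proof -
  let ?N = "marcinkiewicz_norm \<phi>"
  obtain C0 where "\<forall>n::nat. \<exists>\<delta>>0. \<forall>t. 0 < t \<and> t \<le> \<delta> \<and> t \<le> 1 \<longrightarrow>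
      \<phi> (min 1 (real n * t)) \<le> C0 * \<phi> t"
    using assms(5) unfolding has_bounded_dilations_def by blast
  then obtain \<delta> :: "nat \<Rightarrow> real" where \<delta>: "\<And>n. 0 < \<delta> n"
      "\<And>n t. 0 < t \<Longrightarrow> t \<le> \<delta> n \<Longrightarrow> t \<le> 1 \<Longrightarrow> \<phi> (min 1 (real n * t)) \<le> C0 * \<phi> t"
    by metis
  define C where "C = max 2 C0"
  have C: "0 \<le> C" by (simp add: C_def)
  \<comment> \<open>\<open>c (Suc j)\<close> is made small enough for dilations by
    \<open>Suc j + 2\<close>. At \<open>c 0 = 1\<close> no smallness is available, and
    quasi-concavity gives the factor 2 there; hence the 2 in \<open>C\<close>.\<close>
  define c where "c = rec_nat 1 (\<lambda>j v. min (v / 2) (\<delta> (Suc j + 2)))"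
  have c_0: "c 0 = 1" and c_Suc: "c (Suc j) = min (c j / 2) (\<delta> (Suc j + 2))" for j
    by (simp_all add: c_def)
  have c_pos: "0 < c j" for j
    by (induction j) (auto simp: c_0 c_Suc \<delta>)
  have c_half: "c (Suc j) \<le> c j / 2" for j by (simp add: c_Suc)
  have c_dec: "c (Suc j) \<le> c j" for j using c_half[of j] c_pos[of j] by linarith
  have c_le: "c j \<le> (1/2) ^ j" for j
  proof (induction j)
    case (Suc j)
    then show ?case using c_half[of j] by simp
  qed (simp add: c_0)
  have c_le_1: "c j \<le> 1" for j
    using c_le[of j] power_le_one[of "1/2::real" j] by simp
  have c_lim: "c \<longlonglongrightarrow> 0"
    by (rule tendsto_sandwich[OF _ _ tendsto_const LIMSEQ_power_zero[of "1/2::real"]])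
       (use c_le c_pos in \<open>auto simp: less_imp_le\<close>)
  have dil: "\<phi> (min 1 (real (j + 2) * s)) \<le> C * \<phi> s" if s: "0 < s" "s \<le> c j" for j s
  proof -
    have s1: "s \<le> 1" using s c_le_1[of j] by linarith
    have "\<phi> (min 1 (real (j + 2) * s)) \<le> 2 * \<phi> s \<or> \<phi> (min 1 (real (j + 2) * s)) \<le> C0 * \<phi> s"
    proof (cases j)
      case 0
      then show ?thesis using s s1 by (intro disjI1 dilation_le) auto
    next
      case (Suc i)
      then have "s \<le> \<delta> (j + 2)" using s by (simp add: c_Suc)
      from \<delta>(2)[OF s(1) this s1] show ?thesis ..
    qed
    moreover have "2 * \<phi> s \<le> C * \<phi> s" "C0 * \<phi> s \<le> C * \<phi> s"
      using nonneg[of s] s s1 by (auto simp: C_def intro!: mult_right_mono)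
    ultimately show ?thesis by linarith
  qed
  obtain w where w: "nontrivial_weight w" "\<And>s. w s \<le> 1"
    "\<And>s j. s \<in> {0..1} \<Longrightarrow> w s \<le> (1/2) ^ j \<Longrightarrow> s \<le> c j"
    using rapidly_decreasing_weight[OF c_0 c_pos c_dec c_lim] by blast
  define M where "M = \<kappa> * T / (1 - \<kappa>) * C"
  have M: "0 < M" using \<kappa> T by (simp add: M_def C_def)
  \<comment> \<open>Stated for a single family, to be applied to \<open>x\<close> and to
    \<open>y\<close> with the same \<open>V\<close>.\<close>
  have family: "?N (\<lambda>s. \<Sum>i=1..n. z i s) \<le> M * V \<and> (\<forall>i\<in>{1..n}. ?N (z i) \<le> ?N (\<lambda>s. \<Sum>i=1..n. z i s))"
    if n: "1 \<le> n" and z: "\<And>i. i \<in> {1..n} \<Longrightarrow> z i \<in> marcinkiewicz_space \<phi>"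
      and V: "0 \<le> V" "\<And>i. i \<in> {1..n} \<Longrightarrow> ?N (z i) \<le> V"
      and disj: "AE s in lebesgue. s \<in> {0..1} \<longrightarrow> (\<forall>i\<in>{1..n}. \<forall>j\<in>{1..n}. i \<noteq> j \<longrightarrow> z i s = 0 \<or> z j s = 0)"
      and supp: "AE s in lebesgue. s \<in> {0..1} \<longrightarrow> (\<forall>i\<in>{1..n}. z i s \<noteq> 0 \<longrightarrow> s \<le> c (i - 1))"
    for n V and z :: "nat \<Rightarrow> real \<Rightarrow> real"
  proof -
    have meas: "z i \<in> borel_measurable (lebesgue_on {0..1})"
      and fin: "marcinkiewicz_enorm \<phi> (z i) < top" if "i \<in> {1..n}" for i
      using z[OF that] by (auto simp: marcinkiewicz_space_def)
    have meas_sum: "(\<lambda>s. \<Sum>i=1..n. z i s) \<in> borel_measurable (lebesgue_on {0..1})"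
      using meas by (intro borel_measurable_sum) auto
    have weak: "l * \<phi> (distribution_function (z i) l) \<le> V" if "i \<in> {1..n}" "0 < l" for i l
    proof -
      have "ennreal (l * \<phi> (distribution_function (z i) l)) \<le> ennreal (?N (z i))"
        using weak_le_enorm[OF meas[OF that(1)] that(2)] fin[OF that(1)]
        by (simp add: marcinkiewicz_norm_def)
      then have "l * \<phi> (distribution_function (z i) l) \<le> ?N (z i)"
        by (simp add: ennreal_le_iff marcinkiewicz_norm_def)
      with V(2)[OF that(1)] show ?thesis by simp
    qed
    have "marcinkiewicz_enorm \<phi> (\<lambda>s. \<Sum>i=1..n. z i s) \<le> ennreal (\<kappa> * T / (1 - \<kappa>) * (C * V))"
    proof (rule enorm_le_weak[OF T \<kappa> contr meas_sum])
      show "0 \<le> C * V" using V by (simp add: C_def)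
      show "l * \<phi> (distribution_function (\<lambda>s. \<Sum>i=1..n. z i s) l) \<le> C * V" if "0 < l" for l
        by (rule weak_estimate_disjoint_sum[OF c_0 c_pos c_half dil C n meas disj supp V(1) weak that])
    qed
    then have le: "marcinkiewicz_enorm \<phi> (\<lambda>s. \<Sum>i=1..n. z i s) \<le> ennreal (M * V)"
      by (simp add: M_def mult_ac)
    then have "?N (\<lambda>s. \<Sum>i=1..n. z i s) \<le> M * V"
      unfolding marcinkiewicz_norm_def using V M by (intro enn2real_leI) auto
    moreover have "?N (z i) \<le> ?N (\<lambda>s. \<Sum>i=1..n. z i s)" if i: "i \<in> {1..n}" for i
      unfolding marcinkiewicz_norm_def
    proof (rule enn2real_mono)
      show "marcinkiewicz_enorm \<phi> (z i) \<le> marcinkiewicz_enorm \<phi> (\<lambda>s. \<Sum>i=1..n. z i s)"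
        by (rule enorm_mono[OF meas[OF i] meas_sum])
           (rule distribution_function_le_disjoint_sum[OF meas disj i])
      show "marcinkiewicz_enorm \<phi> (\<lambda>s. \<Sum>i=1..n. z i s) < top"
        using le ennreal_less_top by (rule le_less_trans)
    qed
    ultimately show ?thesis by blast
  qed
  have "decomposable w (marcinkiewicz_space \<phi>) ?N"
    unfolding decomposable_def
  proof (intro exI[of _ M] conjI allI impI; (elim conjE)?)
    fix n :: nat and x y :: "nat \<Rightarrow> real \<Rightarrow> real"
    assume n: "1 \<le> n"
      and xy: "\<forall>i\<in>{1..n}. x i \<in> marcinkiewicz_space \<phi> \<and> y i \<in> marcinkiewicz_space \<phi> \<and>
        nonzero_function (x i) \<and> nonzero_function (y i) \<and> ?N (x i) = ?N (y i)"
      and sep: "\<forall>i\<in>{1..<n}. inf_on w (supp (x i) \<union> supp (y i)) \<ge>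
        2 * sup_on w (supp (x (i + 1)) \<union> supp (y (i + 1)))"
    define S where "S i = supp (x i) \<union> supp (y i)" for i
    have nonnull: "\<not> (AE s in lebesgue. s \<notin> S i)" if "i \<in> {1..n}" for i
    proof
      assume "AE s in lebesgue. s \<notin> S i"
      then have "AE s in lebesgue. s \<notin> supp (x i)" by eventually_elim (simp add: S_def)
      with xy that show False by (auto simp: nonzero_function_iff)
    qed
    obtain wS: "AE s in lebesgue. \<forall>i\<in>{1..n}. s \<in> S i \<longrightarrow> w s \<le> (1/2) ^ (i - 1)"
      and dS: "AE s in lebesgue. \<forall>i\<in>{1..n}. \<forall>j\<in>{1..n}. i \<noteq> j \<longrightarrow> s \<notin> S i \<or> s \<notin> S j"
    proof (rule separated_supports[of w n S])
      show "w \<in> borel_measurable (lebesgue_on {0..1})" "AE s in lebesgue_on {0..1}. 0 < w s"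
        using w(1) by (auto simp: nontrivial_weight_def weight_def)
      show "S i \<in> sets lebesgue" if "i \<in> {1..n}" for i
        using xy that by (auto simp: S_def marcinkiewicz_space_def intro!: sets_supp)
      show "S i \<subseteq> {0..1}" for i by (auto simp: S_def supp_def)
      show "2 * sup_on w (S (i + 1)) \<le> inf_on w (S i)" if "i \<in> {1..<n}" for i
        using sep that by (simp add: S_def)
    qed (use w(2) nonnull in auto)
    define V where "V = Max ((\<lambda>i. ?N (x i)) ` {1..n})"
    have "V \<in> (\<lambda>i. ?N (x i)) ` {1..n}" unfolding V_def using n by (intro Max_in) auto
    then obtain k where k: "k \<in> {1..n}" "V = ?N (x k)" by auto
    have Vx: "?N (x i) \<le> V" if "i \<in> {1..n}" for i
      unfolding V_def using that by (intro Max_ge) auto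
    have V0: "0 \<le> V" by (simp add: k marcinkiewicz_norm_def)
    have disj: "AE s in lebesgue. s \<in> {0..1} \<longrightarrow> (\<forall>i\<in>{1..n}. \<forall>j\<in>{1..n}. i \<noteq> j \<longrightarrow> z i s = 0 \<or> z j s = 0)"
      if "\<And>i. supp (z i) \<subseteq> S i" for z
      using dS
    proof eventually_elim
      case (elim s)
      have "s \<in> S i" if "s \<in> {0..1}" "z i s \<noteq> 0" for i
        using that \<open>\<And>i. supp (z i) \<subseteq> S i\<close>[of i] by (auto simp: supp_def)
      with elim show ?case by blast
    qed
    have supp: "AE s in lebesgue. s \<in> {0..1} \<longrightarrow> (\<forall>i\<in>{1..n}. z i s \<noteq> 0 \<longrightarrow> s \<le> c (i - 1))"
      if "\<And>i. supp (z i) \<subseteq> S i" for z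
      using wS
    proof eventually_elim
      case (elim s)
      have "s \<in> S i" if "s \<in> {0..1}" "z i s \<noteq> 0" for i
        using that \<open>\<And>i. supp (z i) \<subseteq> S i\<close>[of i] by (auto simp: supp_def)
      with elim w(3) show ?case by blast
    qed
    have sx: "supp (x i) \<subseteq> S i" and sy: "supp (y i) \<subseteq> S i" for i by (auto simp: S_def)
    have fx: "?N (\<lambda>s. \<Sum>i=1..n. x i s) \<le> M * V \<and> (\<forall>i\<in>{1..n}. ?N (x i) \<le> ?N (\<lambda>s. \<Sum>i=1..n. x i s))"
      using n xy Vx by (intro family V0 disj[OF sx] supp[OF sx]) auto
    have fy: "?N (\<lambda>s. \<Sum>i=1..n. y i s) \<le> M * V \<and> (\<forall>i\<in>{1..n}. ?N (y i) \<le> ?N (\<lambda>s. \<Sum>i=1..n. y i s))"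
      using n xy Vx by (intro family V0 disj[OF sy] supp[OF sy]) auto
    have "V \<le> ?N (\<lambda>s. \<Sum>i=1..n. x i s)" "V \<le> ?N (\<lambda>s. \<Sum>i=1..n. y i s)"
      using fx fy k xy by auto
    then have "M * V \<le> M * ?N (\<lambda>s. \<Sum>i=1..n. x i s)" "M * V \<le> M * ?N (\<lambda>s. \<Sum>i=1..n. y i s)"
      using M by simp_all
    with fx fy have 1: "?N (\<lambda>s. \<Sum>i=1..n. x i s) \<le> M * ?N (\<lambda>s. \<Sum>i=1..n. y i s)"
      and 2: "?N (\<lambda>s. \<Sum>i=1..n. y i s) \<le> M * ?N (\<lambda>s. \<Sum>i=1..n. x i s)" by linarith+
    from 1 show "inverse M * ?N (\<lambda>s. \<Sum>i=1..n. x i s) \<le> ?N (\<lambda>s. \<Sum>i=1..n. y i s)"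
      using M by (simp add: field_simps)
    from 2 show "?N (\<lambda>s. \<Sum>i=1..n. y i s) \<le> M * ?N (\<lambda>s. \<Sum>i=1..n. x i s)" .
  qed (rule M)
  with w(1) show ?thesis by blast
qed

section \<open>Layers of a non-trivial weight\<close>

text \<open>The measure of \<open>A \<inter> {0..r}\<close> is 1-Lipschitz in \<open>r\<close>, so
  the intermediate value theorem applies.\<close>

lemma lebesgue_subset_of_measure:
  fixes A :: "real set"
  assumes A: "A \<in> sets lebesgue" "A \<subseteq> {0..1}" and m: "0 \<le> m" "m \<le> measure lebesgue A"
  obtains B where "B \<in> sets lebesgue" "B \<subseteq> A" "measure lebesgue B = m"
proof -
  define f where "f r = measure lebesgue (A \<inter> {0..r})" for r
  have meas: "A \<inter> {0..r} \<in> lmeasurable" for r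
    by (rule fmeasurableI2[of "{0..r}"]) (use A in auto)
  have mono: "f r \<le> f s" if "r \<le> s" for r s
    unfolding f_def using that by (intro measure_mono_fmeasurable fmeasurableD meas) auto
  have incr: "f s \<le> f r + (s - r)" if "r \<le> s" for r s
  proof -
    have "f s \<le> measure lebesgue ((A \<inter> {0..r}) \<union> {r..s})"
      unfolding f_def by (intro measure_mono_fmeasurable fmeasurable.Un fmeasurableD meas) auto
    also have "\<dots> \<le> f r + measure lebesgue {r..s}"
      unfolding f_def by (intro measure_Un_le fmeasurableD meas) auto
    finally show ?thesis using that by simp
  qed
  have "1-lipschitz_on {0..1} f"
  proof (rule lipschitz_onI)
    fix r s :: real
    show "dist (f r) (f s) \<le> 1 * dist r s"
      using mono[of r s] mono[of s r] incr[of r s] incr[of s r]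
      by (cases "r \<le> s") (auto simp: dist_real_def)
  qed simp
  then have "continuous_on {0..1} f" by (rule lipschitz_on_continuous_on)
  moreover have "f 0 \<le> m"
  proof -
    have "f 0 \<le> measure lebesgue {0::real}"
      unfolding f_def by (intro measure_mono_fmeasurable fmeasurableD meas) (auto simp: fmeasurable_def)
    then show ?thesis using m by simp
  qed
  moreover have "A \<inter> {0..1} = A" using A by auto
  then have "m \<le> f 1" using m by (simp add: f_def)
  ultimately obtain r where "f r = m" using IVT'[of f 0 m 1] by auto
  with meas[of r] show thesis by (intro that[of "A \<inter> {0..r}"]) (auto simp: f_def)
qed

text \<open>If \<open>w\<close> is unbounded, some bounded layer above each \<open>a\<close> has
  positive measure, since otherwise \<open>w \<le> a\<close> almost everywhere; layers are then
  collected upwards. If \<open>1 / w\<close> is unbounded, the same works downwards from each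
  positive \<open>b\<close>.\<close>

lemma nontrivial_weight_layers:
  assumes w: "nontrivial_weight w"
  obtains l u :: "nat \<Rightarrow> real" where "\<And>i. i \<in> {1..n} \<Longrightarrow> 0 < l i"
    "\<And>i. i \<in> {1..n} \<Longrightarrow> 0 < measure lebesgue {s\<in>{0..1}. l i \<le> w s \<and> w s \<le> u i}"
    "\<And>i. i \<in> {1..<n} \<Longrightarrow> 2 * u (i + 1) \<le> l i"
proof -
  define P where "P a b \<longleftrightarrow> 0 < measure lebesgue {s\<in>{0..1}. a \<le> w s \<and> w s \<le> b}" for a b
  have meas: "w \<in> borel_measurable (lebesgue_on {0..1})" and
    pos: "AE s in lebesgue. s \<in> {0..1} \<longrightarrow> 0 < w s"
    using w by (auto simp: nontrivial_weight_def weight_def AE_unit_interval_iff)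
  have not_P: "AE s in lebesgue. s \<in> {0..1} \<longrightarrow> \<not> (a \<le> w s \<and> w s \<le> b)" if "\<not> P a b" for a b
  proof -
    let ?A = "{s\<in>{0..1}. a \<le> w s \<and> w s \<le> b}"
    have "{s\<in>space (lebesgue_on {0..1}). a \<le> w s \<and> w s \<le> b} \<in> sets (lebesgue_on {0..1})"
      using meas by measurable
    then have sets: "?A \<in> sets lebesgue" by (simp add: sets_restrict_space_iff)
    then have fm: "?A \<in> lmeasurable" by (rule fmeasurableI2[of "{0..1::real}", rotated 2]) auto
    have m0: "measure lebesgue ?A = 0"
      using that measure_nonneg[of lebesgue ?A] unfolding P_def by linarith
    have "emeasure lebesgue ?A = 0"
      unfolding emeasure_eq_measure2[OF fm] m0 by (rule ennreal_0)
    then have "?A \<in> null_sets lebesgue" using sets by (rule null_setsI)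
    then have "AE s in lebesgue. s \<notin> ?A" by (rule AE_not_in)
    then show ?thesis by (rule AE_mp) (rule AE_I2, blast)
  qed
  consider "\<not> essentially_bounded_above w" | "\<not> essentially_bounded_above (\<lambda>s. 1 / w s)"
    using w by (auto simp: nontrivial_weight_def)
  then show thesis
  proof cases
    case 1
    have "\<exists>b. P a b" for a
    proof (rule ccontr)
      assume "\<not> ?thesis"
      then have "\<forall>k::nat. AE s in lebesgue. s \<in> {0..1} \<longrightarrow> \<not> (a \<le> w s \<and> w s \<le> real k)"
        using not_P by blast
      then have "AE s in lebesgue. \<forall>k::nat. s \<in> {0..1} \<longrightarrow> \<not> (a \<le> w s \<and> w s \<le> real k)"
        by (rule AE_all_countable[THEN iffD2])
      then have "AE s in lebesgue. s \<in> {0..1} \<longrightarrow> w s \<le> a"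
      proof eventually_elim
        case (elim s)
        obtain k :: nat where "w s \<le> real k" using real_arch_simple by blast
        with elim show ?case by (meson linear)
      qed
      with 1 show False by (auto simp: essentially_bounded_above_def AE_unit_interval_iff)
    qed
    then obtain uf where uf: "\<And>a. P a (uf a)" by metis
    \<comment> \<open>The maximum with \<open>v\<close> makes positivity of the levels
      immediate.\<close>
    define L where "L = rec_nat 1 (\<lambda>_ v. max v (2 * uf v))"
    have L: "L 0 = 1" "L (Suc k) = max (L k) (2 * uf (L k))" for k by (simp_all add: L_def)
    have L_pos: "0 < L k" for k by (induction k) (auto simp: L)
    show thesis
    \<comment> \<open>The levels grow along the recursion while the layers must descend as
      \<open>i\<close> grows, hence the reversal \<open>n - i\<close>.\<close>
    proof (rule that[of "\<lambda>i. L (n - i)" "\<lambda>i. uf (L (n - i))"])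
      fix i assume "i \<in> {1..<n}"
      then have "n - i = Suc (n - (i + 1))" by auto
      then show "2 * uf (L (n - (i + 1))) \<le> L (n - i)" by (simp add: L)
    qed (use L_pos uf in \<open>auto simp: P_def\<close>)
  next
    case 2
    have "\<exists>a>0. P a b" if b: "0 < b" for b
    proof (rule ccontr)
      assume "\<not> ?thesis"
      then have "\<forall>k::nat. AE s in lebesgue. s \<in> {0..1} \<longrightarrow> \<not> (inverse (real (Suc k)) \<le> w s \<and> w s \<le> b)"
        using not_P by (metis inverse_positive_iff_positive of_nat_0_less_iff zero_less_Suc)
      then have "AE s in lebesgue. \<forall>k::nat. s \<in> {0..1} \<longrightarrow> \<not> (inverse (real (Suc k)) \<le> w s \<and> w s \<le> b)"
        by (rule AE_all_countable[THEN iffD2])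
      with pos have "AE s in lebesgue. s \<in> {0..1} \<longrightarrow> 1 / w s \<le> 1 / b"
      proof eventually_elim
        case (elim s)
        show ?case
        proof
          assume s: "s \<in> {0..1}"
          with elim obtain k where "inverse (real (Suc k)) < w s" using reals_Archimedean by blast
          with elim s have "b < w s" by (meson less_imp_le not_le)
          with b show "1 / w s \<le> 1 / b" by (intro frac_le) auto
        qed
      qed
      with 2 show False by (auto simp: essentially_bounded_above_def AE_unit_interval_iff)
    qed
    then obtain lf where lf: "\<And>b. 0 < b \<Longrightarrow> 0 < lf b" "\<And>b. 0 < b \<Longrightarrow> P (lf b) b" by metis
    define U where "U = rec_nat 1 (\<lambda>_ v. lf v / 2)"
    have U: "U 0 = 1" "U (Suc k) = lf (U k) / 2" for k by (simp_all add: U_def)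
    have U_pos: "0 < U k" for k by (induction k) (auto simp: U lf)
    show thesis
      by (rule that[of "\<lambda>i. lf (U i)" U]) (use U_pos lf in \<open>auto simp: P_def U\<close>)
  qed
qed

section \<open>Normalised indicators as test functions\<close>

text \<open>The subtracted term makes the estimate strong enough for the induction.\<close>

lemma sum_geometric_tail_le: "k \<le> n \<Longrightarrow> (\<Sum>i=k..n. 1 / 2 ^ i) \<le> 2 / 2 ^ k - (1::real) / 2 ^ n"
proof (induction n rule: dec_induct)
  case (step m)
  have "1 / 2 ^ m = 2 * ((1::real) / 2 ^ Suc m)" by simp
  moreover have "(\<Sum>i=k..Suc m. 1 / (2::real) ^ i) = (\<Sum>i=k..m. 1 / 2 ^ i) + 1 / 2 ^ Suc m"
    using step by (subst sum.cl_ivl_Suc) simp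
  ultimately show ?case using step.IH by linarith
qed simp

text \<open>At level \<open>l\<close> only the indices in \<open>I\<close> count. Their measures add
  up to at most twice the largest one, \<open>a / 2 ^ k\<close> with \<open>k = Min I\<close>, and
  doubling the argument costs \<open>\<phi>\<close> at most a factor 2. The bound is independent of
  \<open>n\<close>.\<close>

lemma (in fundamental_function) weak_estimate_geometric_indicators:
  fixes B :: "nat \<Rightarrow> real set"
  assumes B: "\<And>i. i \<in> {1..n} \<Longrightarrow> B i \<in> sets lebesgue" "\<And>i. i \<in> {1..n} \<Longrightarrow> B i \<subseteq> {0..1}"
      "\<And>i. i \<in> {1..n} \<Longrightarrow> measure lebesgue (B i) = a / 2 ^ i"
    and disj: "disjoint_family_on B {1..n}" and a: "0 < a" "a \<le> 1" and l: "0 < l"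
  shows "l * \<phi> (distribution_function (\<lambda>s. \<Sum>i=1..n. 1 / \<phi> (a / 2 ^ i) * indicator (B i) s) l) \<le> 2"
proof -
  let ?b = "\<lambda>i. a / 2 ^ i"
  let ?x = "\<lambda>i s. 1 / \<phi> (?b i) * indicator (B i) s :: real"
  let ?D = "distribution_function (\<lambda>s. \<Sum>i=1..n. ?x i s) l"
  have b: "0 < ?b i" "?b i \<le> 1" for i
    using a by (auto simp: field_simps intro: order_trans[of a 1])
  define I where "I = {i\<in>{1..n}. l < 1 / \<phi> (?b i)}"
  have "?D \<le> (\<Sum>i=1..min n n. distribution_function (?x i) l) + 0"
  proof (rule distribution_function_disjoint_sum_le)
    show "AE s in lebesgue. s \<in> {0..1} \<longrightarrow>
        (\<forall>i\<in>{1..n}. \<forall>j\<in>{1..n}. i \<noteq> j \<longrightarrow> ?x i s = 0 \<or> ?x j s = 0)"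
      using disj by (intro AE_I2) (auto simp: disjoint_family_on_def indicator_def)
    show "?x i \<in> borel_measurable (lebesgue_on {0..1})" if "i \<in> {1..n}" for i
      using B(1)[OF that] by (rule borel_measurable_scaled_indicator)
  qed (use l in auto)
  also have "\<dots> = (\<Sum>i=1..n. if l < 1 / \<phi> (?b i) then ?b i else 0)"
  proof -
    have "distribution_function (?x i) l = (if l < 1 / \<phi> (?b i) then ?b i else 0)" if "i \<in> {1..n}" for i
      using B[OF that] pos[OF b, of i] l by (intro distribution_function_indicator) auto
    then show ?thesis by (simp only: min.idem add_0_right) (rule sum.cong[OF refl])
  qed
  also have "\<dots> = (\<Sum>i\<in>I. ?b i)"
    unfolding I_def by (rule sum.inter_filter[symmetric]) simp
  finally have D: "?D \<le> (\<Sum>i\<in>I. ?b i)" .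
  show ?thesis
  proof (cases "I = {}")
    case True
    with D have "?D = 0" using distribution_function_nonneg antisym by fastforce
    then show ?thesis by simp
  next
    case False
    define k where "k = Min I"
    have fin: "finite I" by (simp add: I_def)
    have k: "k \<in> I" unfolding k_def using fin False by (rule Min_in)
    have "(\<Sum>i\<in>I. ?b i) \<le> (\<Sum>i=k..n. ?b i)"
      using fin b by (intro sum_mono2) (auto simp: k_def I_def less_imp_le)
    also have "\<dots> = a * (\<Sum>i=k..n. 1 / 2 ^ i)" by (simp add: sum_distrib_left)
    also have "\<dots> \<le> a * (2 / 2 ^ k)"
    proof (rule mult_left_mono)
      have "(\<Sum>i=k..n. 1 / 2 ^ i) \<le> 2 / 2 ^ k - (1::real) / 2 ^ n"
        using k by (intro sum_geometric_tail_le) (simp add: I_def)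
      also have "\<dots> \<le> 2 / 2 ^ k" by simp
      finally show "(\<Sum>i=k..n. 1 / 2 ^ i) \<le> 2 / (2::real) ^ k" .
    qed (use a in simp)
    finally have "?D \<le> a * (2 / 2 ^ k)" by (rule order_trans[OF D])
    then have "?D \<le> 2 * ?b k" by (simp only: times_divide_eq_right mult.commute)
    then have "\<phi> ?D \<le> 2 * \<phi> (?b k)"
      using b[of k] by (intro dilation_le distribution_function_le_1) auto
    then have "l * \<phi> ?D \<le> l * (2 * \<phi> (?b k))" using l by simp
    also have "\<dots> \<le> 2" using k pos[OF b, of k] by (simp add: I_def field_simps)
    finally show ?thesis .
  qed
qed

text \<open>\<open>K\<close> bounds the norm of the sum of geometric indicators for every
  \<open>n\<close>, so \<open>C * K\<close> is uniform. The threshold for \<open>t\<close> is the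
  least measure \<open>a\<close> of the \<open>n\<close> layers, and it may depend on
  \<open>n\<close>.\<close>

lemma (in fundamental_function) bounded_dilations_if_decomposable:
  assumes T: "1 < T" and \<kappa>: "0 < \<kappa>" "\<kappa> < 1"
    and contr: "\<And>s. 0 < s \<Longrightarrow> s * T \<le> 1 \<Longrightarrow> \<phi> (s * T) \<le> \<kappa> * T * \<phi> s"
    and w: "nontrivial_weight w"
    and dec: "decomposable w (marcinkiewicz_space \<phi>) (marcinkiewicz_norm \<phi>)"
  shows "has_bounded_dilations \<phi>"
proof -
  let ?N = "marcinkiewicz_norm \<phi>"
  define K where "K = \<kappa> * T / (1 - \<kappa>) * 2"
  have K: "0 < K" using T \<kappa> by (simp add: K_def)
  obtain C where C: "0 < C"
    and all: "\<forall>n\<ge>1. \<forall>(x :: nat \<Rightarrow> real \<Rightarrow> real) y.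
        (\<forall>i\<in>{1..n}. x i \<in> marcinkiewicz_space \<phi> \<and> y i \<in> marcinkiewicz_space \<phi> \<and>
           nonzero_function (x i) \<and> nonzero_function (y i) \<and> ?N (x i) = ?N (y i)) \<and>
        (\<forall>i\<in>{1..<n}. inf_on w (supp (x i) \<union> supp (y i)) \<ge>
           2 * sup_on w (supp (x (i + 1)) \<union> supp (y (i + 1)))) \<longrightarrow>
        inverse C * ?N (\<lambda>s. \<Sum>i=1..n. x i s) \<le> ?N (\<lambda>s. \<Sum>i=1..n. y i s) \<and>
        ?N (\<lambda>s. \<Sum>i=1..n. y i s) \<le> C * ?N (\<lambda>s. \<Sum>i=1..n. x i s)"
    using dec unfolding decomposable_def by (elim exE conjE) (rule that)
  have upper: "?N (\<lambda>s. \<Sum>i=1..n. y i s) \<le> C * ?N (\<lambda>s. \<Sum>i=1..n. x i s)"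
    if "1 \<le> n"
      "\<And>i. i \<in> {1..n} \<Longrightarrow> x i \<in> marcinkiewicz_space \<phi> \<and> y i \<in> marcinkiewicz_space \<phi> \<and>
        nonzero_function (x i) \<and> nonzero_function (y i) \<and> ?N (x i) = ?N (y i)"
      "\<And>i. i \<in> {1..<n} \<Longrightarrow> 2 * sup_on w (supp (x (i + 1)) \<union> supp (y (i + 1))) \<le>
        inf_on w (supp (x i) \<union> supp (y i))" for n and x y :: "nat \<Rightarrow> real \<Rightarrow> real"
    by (rule all[THEN spec[of _ n], THEN mp, OF that(1), THEN spec[of _ x], THEN spec[of _ y],
          THEN mp, THEN conjunct2]) (intro conjI ballI that(2,3); assumption)
  have meas_w: "w \<in> borel_measurable (lebesgue_on {0..1})"
    using w by (auto simp: nontrivial_weight_def weight_def)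
  have "\<exists>\<delta>>0. \<forall>t. 0 < t \<and> t \<le> \<delta> \<and> t \<le> 1 \<longrightarrow> \<phi> (min 1 (real n * t)) \<le> (C * K) * \<phi> t" for n :: nat
  proof (cases "n = 0")
    case True
    then show ?thesis using C K nonneg by (intro exI[of _ 1]) auto
  next
    case False
    obtain l u :: "nat \<Rightarrow> real" where l: "\<And>i. i \<in> {1..n} \<Longrightarrow> 0 < l i"
      and A_pos: "\<And>i. i \<in> {1..n} \<Longrightarrow> 0 < measure lebesgue {s\<in>{0..1}. l i \<le> w s \<and> w s \<le> u i}"
      and lu: "\<And>i. i \<in> {1..<n} \<Longrightarrow> 2 * u (i + 1) \<le> l i"
      by (rule nontrivial_weight_layers[OF w, where n=n]) blast
    define A where "A i = {s\<in>{0..1}. l i \<le> w s \<and> w s \<le> u i}" for i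
    have A_sub: "A i \<subseteq> {0..1}" for i by (auto simp: A_def)
    have A_sets: "A i \<in> sets lebesgue" for i
    proof -
      have "{s\<in>space (lebesgue_on {0..1}). l i \<le> w s \<and> w s \<le> u i} \<in> sets (lebesgue_on {0..1})"
        using meas_w by measurable
      then show ?thesis by (simp add: A_def sets_restrict_space_iff)
    qed
    have l_le_u: "l i \<le> u i" if "i \<in> {1..n}" for i
    proof -
      have "A i \<noteq> {}" using A_pos[OF that] unfolding A_def by (metis less_irrefl measure_empty)
      then show ?thesis by (auto simp: A_def)
    qed
    have u_step: "u (Suc i) \<le> u i" if "1 \<le> i" "Suc i \<le> n" for i
      using lu[of i] l_le_u[of i] l_le_u[of "Suc i"] l[of "Suc i"] that by auto
    have u_anti: "u j \<le> u i" if "i \<le> j" "1 \<le> i" "j \<le> n" for i j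
      using that
    proof (induction j rule: dec_induct)
      case (step j)
      then show ?case using u_step[of j] by simp
    qed simp
    have A_disj: "disjoint_family_on A {1..n}"
    proof -
      have "A i \<inter> A j = {}" if "i \<in> {1..n}" "j \<in> {1..n}" "i < j" for i j
      proof -
        have "u j \<le> u (i + 1)" using that by (intro u_anti) auto
        moreover have "0 < u (i + 1)" using l[of "i + 1"] l_le_u[of "i + 1"] that by auto
        ultimately have "u j < l i" using lu[of i] that by auto
        then show ?thesis by (auto simp: A_def)
      qed
      then show ?thesis unfolding disjoint_family_on_def by (metis Int_commute nat_neq_iff)
    qed
    define a where "a = Min ((\<lambda>i. measure lebesgue (A i)) ` {1..n})"
    have "a \<in> (\<lambda>i. measure lebesgue (A i)) ` {1..n}"
      unfolding a_def using False by (intro Min_in) auto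
    then have a0: "0 < a" using A_pos by (auto simp: A_def)
    have a_le: "a \<le> measure lebesgue (A i)" if "i \<in> {1..n}" for i
      unfolding a_def using that by (intro Min_le) auto
    have "measure lebesgue (A 1) \<le> measure lebesgue {0..1::real}"
      using A_sub A_sets by (intro measure_mono_fmeasurable) auto
    then have a1: "a \<le> 1" using a_le[of 1] False by auto
    have choose: "\<exists>B. \<forall>i\<in>{1..n}. B i \<in> sets lebesgue \<and> B i \<subseteq> A i \<and> measure lebesgue (B i) = m i"
      if m: "\<And>i. i \<in> {1..n} \<Longrightarrow> 0 \<le> m i \<and> m i \<le> a" for m :: "nat \<Rightarrow> real"
    proof (rule bchoice, rule ballI)
      fix i assume i: "i \<in> {1..n}"
      then have "0 \<le> m i" "m i \<le> measure lebesgue (A i)" using m[OF i] a_le[OF i] by auto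
      from lebesgue_subset_of_measure[OF A_sets A_sub this]
      show "\<exists>B. B \<in> sets lebesgue \<and> B \<subseteq> A i \<and> measure lebesgue B = m i" by metis
    qed
    have b: "0 < a / 2 ^ i" "a / 2 ^ i \<le> a" for i
      using a0 by (auto simp: field_simps)
    obtain B where B: "\<And>i. i \<in> {1..n} \<Longrightarrow> B i \<in> sets lebesgue" "\<And>i. i \<in> {1..n} \<Longrightarrow> B i \<subseteq> A i"
        "\<And>i. i \<in> {1..n} \<Longrightarrow> measure lebesgue (B i) = a / 2 ^ i"
      using choose[of "\<lambda>i. a / 2 ^ i"] b less_imp_le[OF b(1)] by metis
    show ?thesis
    proof (intro exI[of _ a] conjI allI impI)
      fix t assume t: "0 < t \<and> t \<le> a \<and> t \<le> 1"
      obtain E where E: "\<And>i. i \<in> {1..n} \<Longrightarrow> E i \<in> sets lebesgue" "\<And>i. i \<in> {1..n} \<Longrightarrow> E i \<subseteq> A i"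
          "\<And>i. i \<in> {1..n} \<Longrightarrow> measure lebesgue (E i) = t"
        using choose[of "\<lambda>i. t"] t by (metis less_imp_le)
      define x where "x i s = 1 / \<phi> (a / 2 ^ i) * indicator (B i) s" for i s
      define y where "y i s = 1 / \<phi> t * indicator (E i) s" for i :: nat and s
      have \<phi>_pos: "0 < \<phi> (a / 2 ^ i)" "0 < \<phi> t" for i
        using t order_trans[OF b(2) a1] b(1) by (auto intro!: pos simp del: divide_le_eq_1_pos zero_less_divide_iff)
      have sub: "supp (x i) \<union> supp (y i) \<subseteq> A i" if "i \<in> {1..n}" for i
        using B(2)[OF that] E(2)[OF that] by (auto simp: supp_def x_def y_def indicator_def split: if_splits)
      have unit: "f \<in> marcinkiewicz_space \<phi> \<and> nonzero_function f \<and> ?N f = 1"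
        if F: "F \<in> sets lebesgue" "F \<subseteq> A i" "measure lebesgue F = m" "0 < m" "m \<le> 1"
          and f: "f = (\<lambda>s. 1 / \<phi> m * indicator F s)" for F m f i
      proof -
        have F': "F \<subseteq> {0..1}" using F A_sub by blast
        have m: "0 < \<phi> m" using F by (intro pos) auto
        have en: "marcinkiewicz_enorm \<phi> f = 1"
          unfolding f using enorm_indicator[OF F(1) F' F(3) F(4), of "1 / \<phi> m"] m by simp
        have meas_f: "f \<in> borel_measurable (lebesgue_on {0..1})"
          unfolding f using F(1) by (rule borel_measurable_scaled_indicator)
        have "supp f = F" using F' m by (auto simp: f supp_def indicator_def)
        moreover have "\<not> (AE s in lebesgue. s \<notin> F)"
        proof
          assume "AE s in lebesgue. s \<notin> F"
          then have "emeasure lebesgue F = 0"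
            by (subst (asm) AE_iff_measurable[where N=F]) (use F in auto)
          then show False using F by (simp add: measure_def)
        qed
        ultimately show ?thesis
          using en meas_f by (simp add: nonzero_function_iff marcinkiewicz_space_def marcinkiewicz_norm_def)
      qed
      have "?N (\<lambda>s. \<Sum>i=1..n. y i s) \<le> C * ?N (\<lambda>s. \<Sum>i=1..n. x i s)"
      proof (rule upper)
        fix i assume i: "i \<in> {1..n}"
        have "x i \<in> marcinkiewicz_space \<phi> \<and> nonzero_function (x i) \<and> ?N (x i) = 1"
          by (rule unit[OF B[OF i] b(1) order_trans[OF b(2) a1]]) (simp add: x_def fun_eq_iff)
        moreover have "y i \<in> marcinkiewicz_space \<phi> \<and> nonzero_function (y i) \<and> ?N (y i) = 1"
          using E[OF i] t by (intro unit[of "E i" i t]) (auto simp: y_def)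
        ultimately show "x i \<in> marcinkiewicz_space \<phi> \<and> y i \<in> marcinkiewicz_space \<phi> \<and>
          nonzero_function (x i) \<and> nonzero_function (y i) \<and> ?N (x i) = ?N (y i)" by simp
      next
        fix i assume i: "i \<in> {1..<n}"
        have mS: "w \<in> borel_measurable (lebesgue_on (supp (x j) \<union> supp (y j)))" for j
          by (rule measurable_restrict_mono[OF meas_w]) (auto simp: supp_def)
        have "sup_on w (supp (x (i + 1)) \<union> supp (y (i + 1))) \<le> ereal (u (i + 1))"
          unfolding sup_on_def using mS[of "i + 1"] sub[of "i + 1"] i
          by (intro esssup_I AE_I2) (auto simp: A_def)
        then have "2 * sup_on w (supp (x (i + 1)) \<union> supp (y (i + 1))) \<le> 2 * ereal (u (i + 1))"
          by (intro ereal_mult_left_mono) auto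
        also have "\<dots> \<le> ereal (l i)" using lu[OF i] by simp
        also have "\<dots> \<le> inf_on w (supp (x i) \<union> supp (y i))"
        proof -
          \<comment> \<open>\<open>inf_on\<close> is a negated essential supremum, so a lower bound
            for \<open>w\<close> is obtained as an upper bound for \<open>- w\<close>.\<close>
          have "esssup (lebesgue_on (supp (x i) \<union> supp (y i))) (\<lambda>s. - ereal (w s)) \<le> - ereal (l i)"
            using mS[of i] sub[of i] i by (intro esssup_I AE_I2) (auto simp: A_def)
          then show ?thesis unfolding inf_on_def by (metis ereal_minus_le_minus ereal_uminus_uminus)
        qed
        finally show "2 * sup_on w (supp (x (i + 1)) \<union> supp (y (i + 1))) \<le>
          inf_on w (supp (x i) \<union> supp (y i))" .
      qed (use False in simp)
      also have "?N (\<lambda>s. \<Sum>i=1..n. x i s) \<le> K"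
      proof -
        have "marcinkiewicz_enorm \<phi> (\<lambda>s. \<Sum>i=1..n. x i s) \<le> ennreal (\<kappa> * T / (1 - \<kappa>) * 2)"
        proof (rule enorm_le_weak[OF T \<kappa> contr])
          show "(\<lambda>s. \<Sum>i=1..n. x i s) \<in> borel_measurable (lebesgue_on {0..1})"
            unfolding x_def using B(1)
            by (intro borel_measurable_sum borel_measurable_scaled_indicator) auto
          have "disjoint_family_on B {1..n}"
            using A_disj B(2) unfolding disjoint_family_on_def by blast
          then show "k * \<phi> (distribution_function (\<lambda>s. \<Sum>i=1..n. x i s) k) \<le> 2" if "0 < k" for k
            unfolding x_def using B A_sub a0 a1 that
            by (intro weak_estimate_geometric_indicators) blast+
        qed auto
        then show ?thesis
          unfolding marcinkiewicz_norm_def using K by (intro enn2real_leI) (auto simp: K_def)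
      qed
      finally have bound: "?N (\<lambda>s. \<Sum>i=1..n. y i s) \<le> C * K" using C by simp
      have E_disj: "disjoint_family_on E {1..n}"
        using A_disj E(2) unfolding disjoint_family_on_def by blast
      let ?U = "\<Union>i\<in>{1..n}. E i"
      have E_fm: "E i \<in> lmeasurable" if "i \<in> {1..n}" for i
        by (rule fmeasurableI2[of "{0..1::real}"]) (use E that A_sub in blast)+
      have U: "?U \<in> sets lebesgue" "?U \<subseteq> {0..1}" using E A_sub by blast+
      have "measure lebesgue ?U = (\<Sum>i=1..n. measure lebesgue (E i))"
        using E_fm E_disj by (intro measure_UNION') (auto simp: disjoint_family_on_def pairwise_def disjnt_def)
      then have mU: "measure lebesgue ?U = real n * t" using E(3) by simp
      \<comment> \<open>The \<open>n\<close> disjoint sets of measure \<open>t\<close> fit into the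
        unit interval, which makes \<open>min 1\<close> inactive.\<close>
      have "measure lebesgue ?U \<le> measure lebesgue {0..1::real}"
        using U by (intro measure_mono_fmeasurable) auto
      then have nt: "real n * t \<le> 1" unfolding mU by simp
      \<comment> \<open>Equal heights make the sum one scaled indicator, whose norm is known
        exactly.\<close>
      have "(\<lambda>s. \<Sum>i=1..n. y i s) = (\<lambda>s. 1 / \<phi> t * indicator ?U s)"
        unfolding y_def sum_distrib_left[symmetric]
        by (simp only: indicator_UN_disjoint[OF finite_atLeastAtMost E_disj])
      then have "marcinkiewicz_enorm \<phi> (\<lambda>s. \<Sum>i=1..n. y i s) = ennreal (1 / \<phi> t * \<phi> (real n * t))"
        using enorm_indicator[OF U mU, of "1 / \<phi> t"] t False \<phi>_pos by simp
      then have "?N (\<lambda>s. \<Sum>i=1..n. y i s) = 1 / \<phi> t * \<phi> (real n * t)"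
        unfolding marcinkiewicz_norm_def using nonneg[of "real n * t"] nt t \<phi>_pos by simp
      with bound have "1 / \<phi> t * \<phi> (real n * t) \<le> C * K" by simp
      then show "\<phi> (min 1 (real n * t)) \<le> (C * K) * \<phi> t"
        using \<phi>_pos nt by (simp add: min_absorb2 field_simps)
    qed (rule a0)
  qed
  then show ?thesis unfolding has_bounded_dilations_def by blast
qed

theorem corollary4p10:
  fixes \<phi> :: "real \<Rightarrow> real"
  assumes "mono_on {0..1} \<phi>"
    and "\<forall>t\<in>{0<..1}. 0 < \<phi> t"
    and "concave_on {0..1} \<phi>"
    and "\<phi> 0 = 0"
    and "upper_dilation_index \<phi> < 1"
  shows "(\<exists>w. nontrivial_weight w \<and>
            decomposable w (marcinkiewicz_space \<phi>) (marcinkiewicz_norm \<phi>)) \<longleftrightarrow>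
         (\<exists>\<psi>. quasi_concave \<psi> \<and> regularly_varying_at_zero_of_order_infinity \<psi> \<and>
            equivalent_functions \<phi> \<psi>)"
proof -
  interpret fundamental_function \<phi>
    by unfold_locales (use assms concave_imp_quasi_concave in auto)
  \<comment> \<open>The index hypothesis enters through this contraction, which makes the weak and
    the strong form of the norm comparable in both directions of the equivalence.\<close>
  obtain T \<kappa> where T: "1 < T" "0 < \<kappa>" "\<kappa> < 1"
    "\<And>s. 0 < s \<Longrightarrow> s * T \<le> 1 \<Longrightarrow> \<phi> (s * T) \<le> \<kappa> * T * \<phi> s"
    using contraction_of_upper_dilation_index[OF assms(5)] by metis
  show ?thesis
    using decomposable_if_bounded_dilations[OF T] bounded_dilations_if_decomposable[OF T]
      has_bounded_dilations_if_equivalent equivalent_slowly_varying_if_bounded_dilations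
    by blast
qed

end
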